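(* Let $T$ be a nonempty set endowed with an arbitrary topology $\tau$, let $f_t:X\to\overline{\mathbb{R}}$, $t\in T$, be convex functions, and let $f:=\sup_{t\in T}f_t$. Then, for every $x\in X$, $$\partial f(x)=\bigcap_{L\in\mathcal{F}(x)}\operatorname{co}\left\{\bigcup_{\gamma\in\widehat{T}(x)}\partial\left(f_\gamma+\mathrm{I}_{L\cap\operatorname{dom}f}\right)(x)\right\}.$$
   Context: $X$ is a real separated (Hausdorff) locally convex space with topological dual $X^*$ endowed with the $w^*$-topology; $\overline{\mathbb{R}}=\mathbb{R}\cup\{\pm\infty\}$, with the convention $(+\infty)+(-\infty)=(-\infty)+(+\infty)=+\infty$, and $\sup\emptyset=-\infty$. For $h:X\to\overline{\mathbb{R}}$, $\operatorname{dom}h=\{x:h(x)<+\infty\}$; $h$ is convex if its epigraph $\{(x,\lambda)\in X\times\mathbb{R}:h(x)\le\lambda\}$ is convex. The subdifferential is $\partial h(x)=\{x^*\in X^*: h(y)\ge h(x)+\langle x^*,y-x\rangle\ \forall y\in X\}$ if $h(x)\in\mathbb{R}$, and $\partial h(x)=\emptyset$ if $h(x)\notin\mathbb{R}$. $\mathrm{I}_A$ is the indicator function ($0$ on $A$, $+\infty$ off $A$), $\operatorname{co}$ is the convex hull. $\mathcal{F}(x)$ is the family of finite-dimensional linear subspaces $L\subset X$ containing $x$. Compactification: $\mathcal{C}(T,[0,1])$ is the set of $\tau$-continuous functions $\varphi:T\to[0,1]$. For $t\in T$, $\gamma_t\in[0,1]^{\mathcal{C}(T,[0,1])}$ is the evaluation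 $\gamma_t(\varphi)=\varphi(t)$. $\widehat{T}$ is the closure of $\{\gamma_t:t\in T\}$ in $[0,1]^{\mathcal{C}(T,[0,1])}$ for the product topology (pointwise convergence). For $\gamma\in\widehat{T}$ and $z\in X$, $f_\gamma(z):=\limsup_{\gamma_t\to\gamma,\ t\in T}f_t(z)$, i.e. the supremum of $\limsup_i f_{t_i}(z)$ over all nets $(t_i)_i\subset T$ with $\gamma_{t_i}\to\gamma$ (constant nets allowed). If $f(x)\in\mathbb{R}$, $\widehat{T}(x):=\{\gamma\in\widehat{T}: f_\gamma(x)\ge f(x)\}$; if $f(x)\notin\mathbb{R}$, $\widehat{T}(x):=\emptyset$. *)

theory Defs
  imports "HOL-Analysis.Analysis"
begin

section \<open>Real separated locally convex spaces\<close>

text \<open>The quantified formula in \<open>locally_convex_0\<close> is the unfolded \<^term>\<open>convex V\<close>, a constant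
  that cannot occur in the specification of a class extending \<open>real_vector\<close>.\<close>

class locally_convex_space = real_vector + topological_ab_group_add + t2_space +
  assumes tendsto_scaleR_Pair:
    "filterlim (\<lambda>p. fst p *\<^sub>R snd p) (nhds (r *\<^sub>R x)) (nhds (r::real) \<times>\<^sub>F nhds x)"
  assumes locally_convex_0:
    "open U \<Longrightarrow> 0 \<in> U \<Longrightarrow> \<exists>V. open V \<and> 0 \<in> V \<and> V \<subseteq> U \<and>
      (\<forall>a\<in>V. \<forall>b\<in>V. \<forall>u\<ge>0. \<forall>v\<ge>0. u + v = 1 \<longrightarrow> u *\<^sub>R a + v *\<^sub>R b \<in> V)"

lemma open_contains_convex_0:
  fixes U :: "'a::locally_convex_space set"
  assumes "open U" "0 \<in> U"
  obtains V where "open V" "convex V" "0 \<in> V" "V \<subseteq> U"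
  using locally_convex_0[OF assms] unfolding convex_def by blast

instance real_normed_vector \<subseteq> locally_convex_space
proof
  fix r :: real and x :: 'a
  show "filterlim (\<lambda>p. fst p *\<^sub>R snd p) (nhds (r *\<^sub>R x)) (nhds r \<times>\<^sub>F nhds x)"
    by (rule tendsto_scaleR[OF filterlim_fst filterlim_snd])
next
  fix U :: "'a set"
  assume "open U" "0 \<in> U"
  then obtain e where "e > 0" "ball 0 e \<subseteq> U"
    by (meson open_contains_ball)
  then have "open (ball (0::'a) e) \<and> 0 \<in> ball (0::'a) e \<and> ball 0 e \<subseteq> U \<and> convex (ball (0::'a) e)"
    by auto
  then show "\<exists>V. open V \<and> 0 \<in> V \<and> V \<subseteq> U \<and>
      (\<forall>a\<in>V. \<forall>b\<in>V. \<forall>u\<ge>0. \<forall>v\<ge>0. u + v = 1 \<longrightarrow> u *\<^sub>R a + v *\<^sub>R b \<in> V)"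
    unfolding convex_def by blast
qed

section \<open>The topological dual\<close>

typedef (overloaded) 'a dual =
    "{g :: 'a::locally_convex_space \<Rightarrow> real. linear g \<and> continuous_on UNIV g}"
  morphisms dual_apply Abs_dual
  by (rule exI[of _ "\<lambda>_. 0"]) (auto intro: linear_zero)

setup_lifting type_definition_dual

instantiation dual :: (locally_convex_space) real_vector
begin

lift_definition zero_dual :: "'a dual" is "\<lambda>_. 0"
  by (auto intro: linear_zero)

lift_definition plus_dual :: "'a dual \<Rightarrow> 'a dual \<Rightarrow> 'a dual" is "\<lambda>g h y. g y + h y"
  by (auto intro: linear_compose_add continuous_on_add)

lift_definition uminus_dual :: "'a dual \<Rightarrow> 'a dual" is "\<lambda>g y. - g y"
  by (auto intro: linear_compose_neg continuous_on_minus)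

lift_definition minus_dual :: "'a dual \<Rightarrow> 'a dual \<Rightarrow> 'a dual" is "\<lambda>g h y. g y - h y"
  by (auto intro: linear_compose_sub continuous_on_diff)

lift_definition scaleR_dual :: "real \<Rightarrow> 'a dual \<Rightarrow> 'a dual" is "\<lambda>r g y. r * g y"
  by (auto intro: linear_compose_scale_right[where 'b = real, simplified] continuous_on_mult_left)

instance
  by standard (transfer; auto simp: algebra_simps fun_eq_iff)+

end

section \<open>Convex analysis for extended real functions\<close>

definition eff_dom :: "('a \<Rightarrow> ereal) \<Rightarrow> 'a set" where
  "eff_dom h = {z. h z < \<infinity>}"

definition convex_fun :: "('a::real_vector \<Rightarrow> ereal) \<Rightarrow> bool" where
  "convex_fun h \<longleftrightarrow> convex {(z, r :: real). h z \<le> ereal r}"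

definition subdiff :: "('a::locally_convex_space \<Rightarrow> ereal) \<Rightarrow> 'a \<Rightarrow> 'a dual set" where
  "subdiff h x =
    (if \<bar>h x\<bar> \<noteq> \<infinity> then {xs. \<forall>y. h y \<ge> h x + ereal (dual_apply xs (y - x))} else {})"

definition indicator_fun :: "'a set \<Rightarrow> 'a \<Rightarrow> ereal" where
  "indicator_fun A z = (if z \<in> A then 0 else \<infinity>)"

text \<open>Sums with an indicator rely on \<^term>\<open>\<infinity> + (- \<infinity>) = (\<infinity> :: ereal)\<close>,
  in either order of the summands.\<close>

lemma ereal_add_conflicting_infinities:
  "(\<infinity> :: ereal) + (- \<infinity>) = \<infinity>" "(- \<infinity> :: ereal) + \<infinity> = \<infinity>"
  by simp_all

definition fin_dim_subspaces :: "'a::real_vector \<Rightarrow> 'a set set" where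
  "fin_dim_subspaces x = {L. subspace L \<and> (\<exists>B. finite B \<and> span B = L) \<and> x \<in> L}"

definition sup_fun :: "'t topology \<Rightarrow> ('t \<Rightarrow> 'a \<Rightarrow> ereal) \<Rightarrow> 'a \<Rightarrow> ereal" where
  "sup_fun T f z = (SUP t\<in>topspace T. f t z)"

section \<open>The compactification of the index set\<close>

text \<open>Functions on the carrier of \<open>T\<close> are represented extensionally, so that distinct elements
  are distinct functions on the carrier.\<close>

definition unit_funs :: "'t topology \<Rightarrow> ('t \<Rightarrow> real) set" where
  "unit_funs T =
    {\<phi> \<in> extensional (topspace T). continuous_map T (top_of_set {0..1}) \<phi>}"

definition eval_at :: "'t topology \<Rightarrow> 't \<Rightarrow> ('t \<Rightarrow> real) \<Rightarrow> real" where
  "eval_at T t = (\<lambda>\<phi>\<in>unit_funs T. \<phi> t)"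

definition cube :: "'t topology \<Rightarrow> (('t \<Rightarrow> real) \<Rightarrow> real) topology" where
  "cube T = product_topology (\<lambda>_. top_of_set {0..1}) (unit_funs T)"

definition T_hat :: "'t topology \<Rightarrow> (('t \<Rightarrow> real) \<Rightarrow> real) set" where
  "T_hat T = cube T closure_of (eval_at T ` topspace T)"

text \<open>Nets in the carrier of \<open>T\<close> are represented by proper filters to which the carrier belongs: the
  filter of a net consists of the properties that hold eventually along it.
  Lemmas \<open>limsup_net_le_lim_fun\<close> and \<open>lim_fun_eq_SUP_nets\<close> show that this gives
  exactly the supremum of the upper limits over all nets.\<close>

definition lim_fun ::
    "'t topology \<Rightarrow> ('t \<Rightarrow> 'a \<Rightarrow> ereal) \<Rightarrow> (('t \<Rightarrow> real) \<Rightarrow> real) \<Rightarrow> 'a \<Rightarrow> ereal" where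
  "lim_fun T f \<gamma> z =
    (SUP F\<in>{F. F \<noteq> bot \<and> F \<le> principal (topspace T) \<and> limitin (cube T) (eval_at T) \<gamma> F}.
      Limsup F (\<lambda>t. f t z))"

definition T_hat_at :: "'t topology \<Rightarrow> ('t \<Rightarrow> 'a \<Rightarrow> ereal) \<Rightarrow> 'a \<Rightarrow> (('t \<Rightarrow> real) \<Rightarrow> real) set" where
  "T_hat_at T f x =
    (if \<bar>sup_fun T f x\<bar> \<noteq> \<infinity> then {\<gamma> \<in> T_hat T. lim_fun T f \<gamma> x \<ge> sup_fun T f x} else {})"

definition directed :: "'i set \<Rightarrow> ('i \<Rightarrow> 'i \<Rightarrow> bool) \<Rightarrow> bool" where
  "directed I r \<longleftrightarrow> I \<noteq> {} \<and> (\<forall>i\<in>I. r i i) \<and>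
    (\<forall>i\<in>I. \<forall>j\<in>I. \<forall>k\<in>I. r i j \<longrightarrow> r j k \<longrightarrow> r i k) \<and>
    (\<forall>i\<in>I. \<forall>j\<in>I. \<exists>k\<in>I. r i k \<and> r j k)"

definition tails :: "'i set \<Rightarrow> ('i \<Rightarrow> 'i \<Rightarrow> bool) \<Rightarrow> 'i filter" where
  "tails I r = (INF i\<in>I. principal {j \<in> I. r i j})"

lemma eventually_tails:
  assumes "directed I r"
  shows "eventually P (tails I r) \<longleftrightarrow> (\<exists>i\<in>I. \<forall>j\<in>I. r i j \<longrightarrow> P j)"
proof -
  have trans: "r i k" if "i \<in> I" "j \<in> I" "k \<in> I" "r i j" "r j k" for i j k
    using assms that unfolding directed_def by metis
  have "\<exists>k\<in>I. principal {j \<in> I. r k j} \<le> inf (principal {j \<in> I. r a j}) (principal {j \<in> I. r b j})"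
    if ab: "a \<in> I" "b \<in> I" for a b
  proof -
    obtain k where k: "k \<in> I" "r a k" "r b k"
      using assms ab unfolding directed_def by metis
    have "{j \<in> I. r k j} \<subseteq> {j \<in> I. r a j} \<inter> {j \<in> I. r b j}"
      using trans[OF ab(1) k(1)] trans[OF ab(2) k(1)] k by auto
    with k(1) show ?thesis
      by (intro bexI[of _ k]) simp_all
  qed
  then have "eventually P (tails I r) \<longleftrightarrow> (\<exists>i\<in>I. eventually P (principal {j \<in> I. r i j}))"
    unfolding tails_def using assms
    by (intro eventually_INF_base) (unfold directed_def, blast+)
  then show ?thesis
    by (auto simp: eventually_principal)
qed

lemma Limsup_tails:
  fixes h :: "'i \<Rightarrow> ereal"
  assumes "directed I r"
  shows "Limsup (tails I r) h = (INF i\<in>I. SUP j\<in>{j \<in> I. r i j}. h j)"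
proof (rule antisym)
  show "Limsup (tails I r) h \<le> (INF i\<in>I. SUP j\<in>{j \<in> I. r i j}. h j)"
  proof (rule INF_greatest)
    fix i assume "i \<in> I"
    then have "eventually (\<lambda>j. j \<in> {j \<in> I. r i j}) (tails I r)"
      using eventually_tails[OF assms] by blast
    then have "Limsup (tails I r) h \<le> (SUP j\<in>Collect (\<lambda>j. j \<in> {j \<in> I. r i j}). h j)"
      unfolding Limsup_def by (intro INF_lower) simp
    then show "Limsup (tails I r) h \<le> (SUP j\<in>{j \<in> I. r i j}. h j)"
      by simp
  qed
  show "(INF i\<in>I. SUP j\<in>{j \<in> I. r i j}. h j) \<le> Limsup (tails I r) h"
    unfolding Limsup_def
  proof (rule INF_greatest)
    fix P assume "P \<in> {P. eventually P (tails I r)}"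
    then obtain i where "i \<in> I" "\<forall>j\<in>I. r i j \<longrightarrow> P j"
      using eventually_tails[OF assms] by blast
    then have "(SUP j\<in>{j \<in> I. r i j}. h j) \<le> (SUP j\<in>Collect P. h j)"
      by (intro SUP_subset_mono) auto
    with \<open>i \<in> I\<close> show "(INF i\<in>I. SUP j\<in>{j \<in> I. r i j}. h j) \<le> (SUP j\<in>Collect P. h j)"
      by (rule INF_lower2)
  qed
qed

lemma Limsup_filtermap_eq:
  fixes h :: "'t \<Rightarrow> ereal"
  shows "Limsup (filtermap s G) h = Limsup G (\<lambda>i. h (s i))"
proof (rule antisym)
  show "Limsup (filtermap s G) h \<le> Limsup G (\<lambda>i. h (s i))"
    unfolding Limsup_def
  proof (rule INF_greatest)
    fix P assume P: "P \<in> {P. eventually P G}"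
    then have "eventually (\<lambda>t. t \<in> s ` Collect P) (filtermap s G)"
      by (auto simp: eventually_filtermap elim!: eventually_mono)
    then have "(INF P\<in>{P. eventually P (filtermap s G)}. SUP t\<in>Collect P. h t)
        \<le> (SUP t\<in>Collect (\<lambda>t. t \<in> s ` Collect P). h t)"
      by (intro INF_lower) simp
    then show "(INF P\<in>{P. eventually P (filtermap s G)}. SUP t\<in>Collect P. h t)
        \<le> (SUP i\<in>Collect P. h (s i))"
      by (simp add: image_image)
  qed
  show "Limsup G (\<lambda>i. h (s i)) \<le> Limsup (filtermap s G) h"
    unfolding Limsup_def
  proof (rule INF_greatest)
    fix P assume "P \<in> {P. eventually P (filtermap s G)}"
    then have "eventually (\<lambda>i. P (s i)) G"
      by (simp add: eventually_filtermap)
    then have "(INF P\<in>{P. eventually P G}. SUP i\<in>Collect P. h (s i))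
        \<le> (SUP i\<in>Collect (\<lambda>i. P (s i)). h (s i))"
      by (intro INF_lower) simp
    also have "\<dots> \<le> (SUP t\<in>Collect P. h t)"
      by (rule SUP_least) (auto intro: SUP_upper)
    finally show "(INF P\<in>{P. eventually P G}. SUP i\<in>Collect P. h (s i)) \<le> (SUP t\<in>Collect P. h t)" .
  qed
qed

lemma limsup_net_le_lim_fun:
  assumes "directed I r" and s: "\<And>i. i \<in> I \<Longrightarrow> s i \<in> topspace T"
    and lim: "limitin (cube T) (\<lambda>i. eval_at T (s i)) \<gamma> (tails I r)"
  shows "(INF i\<in>I. SUP j\<in>{j \<in> I. r i j}. f (s j) z) \<le> lim_fun T f \<gamma> z"
proof -
  let ?F = "filtermap s (tails I r)"
  obtain i0 where i0: "i0 \<in> I"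
    using assms(1) unfolding directed_def by blast
  have refl: "r i i" if "i \<in> I" for i
    using assms(1) that unfolding directed_def by blast
  have "?F \<noteq> bot"
    using refl by (auto simp: trivial_limit_def eventually_filtermap eventually_tails[OF assms(1)])
  moreover have "?F \<le> principal (topspace T)"
    using i0 s by (auto simp: le_principal eventually_filtermap eventually_tails[OF assms(1)])
  moreover have "limitin (cube T) (eval_at T) \<gamma> ?F"
    using lim by (simp add: limitin_def eventually_filtermap)
  ultimately have "Limsup ?F (\<lambda>t. f t z) \<le> lim_fun T f \<gamma> z"
    unfolding lim_fun_def by (intro SUP_upper) simp
  then show ?thesis
    by (simp add: Limsup_filtermap_eq Limsup_tails[OF assms(1)])
qed

lemma lim_fun_eq_SUP_nets:
  fixes T :: "'t topology"
  shows "lim_fun T f \<gamma> z =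
    (SUP (I :: ('t \<times> 't set) set, r, s) \<in>
        {(I, r, s). directed I r \<and> s ` I \<subseteq> topspace T \<and>
          limitin (cube T) (\<lambda>i. eval_at T (s i)) \<gamma> (tails I r)}.
      INF i\<in>I. SUP j\<in>{j \<in> I. r i j}. f (s j) z)"
    (is "_ = (SUP _\<in>?N. _)")
proof (rule antisym)
  show "(SUP (I, r, s)\<in>?N. INF i\<in>I. SUP j\<in>{j \<in> I. r i j}. f (s j) z) \<le> lim_fun T f \<gamma> z"
  proof (rule SUP_least, clarify)
    fix I :: "('t \<times> 't set) set" and r s
    assume "directed I r" "s ` I \<subseteq> topspace T"
      and "limitin (cube T) (\<lambda>i. eval_at T (s i)) \<gamma> (tails I r)"
    then show "(INF i\<in>I. SUP j\<in>{j \<in> I. r i j}. f (s j) z) \<le> lim_fun T f \<gamma> z"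
      by (intro limsup_net_le_lim_fun) blast+
  qed
  show "lim_fun T f \<gamma> z \<le> (SUP (I, r, s)\<in>?N. INF i\<in>I. SUP j\<in>{j \<in> I. r i j}. f (s j) z)"
    unfolding lim_fun_def
  proof (rule SUP_least)
    fix F
    assume "F \<in> {F. F \<noteq> bot \<and> F \<le> principal (topspace T) \<and> limitin (cube T) (eval_at T) \<gamma> F}"
    then have F: "F \<noteq> bot" "eventually (\<lambda>t. t \<in> topspace T) F" "limitin (cube T) (eval_at T) \<gamma> F"
      by (auto simp: le_principal)
    define I where "I = {(t, A). t \<in> A \<and> A \<subseteq> topspace T \<and> eventually (\<lambda>t. t \<in> A) F}"
    define r where "r = (\<lambda>(i :: 't \<times> 't set) (j :: 't \<times> 't set). snd j \<subseteq> snd i)"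
    have ne: "\<exists>t. (t, A) \<in> I" if "A \<subseteq> topspace T" "eventually (\<lambda>t. t \<in> A) F" for A
      using that eventually_happens'[OF F(1) that(2)] by (auto simp: I_def)
    have dir: "directed I r"
      unfolding directed_def
    proof (intro conjI ballI)
      show "I \<noteq> {}"
        using ne[of "topspace T"] F(2) by auto
    next
      fix i j assume "i \<in> I" "j \<in> I"
      then have "snd i \<inter> snd j \<subseteq> topspace T" "eventually (\<lambda>t. t \<in> snd i \<inter> snd j) F"
        by (auto simp: I_def eventually_conj_iff)
      then obtain t where "(t, snd i \<inter> snd j) \<in> I"
        using ne by blast
      then show "\<exists>k\<in>I. r i k \<and> r j k"
        by (rule rev_bexI) (auto simp: r_def)
    qed (auto simp: r_def)
    have F_eq: "F = filtermap fst (tails I r)"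
    proof (rule filter_eq_iff[THEN iffD2], intro allI iffI)
      fix P assume "eventually P F"
      with F(2) have ev: "eventually (\<lambda>t. t \<in> {t \<in> topspace T. P t}) F"
        by (auto simp: eventually_conj_iff)
      obtain t where "(t, {t \<in> topspace T. P t}) \<in> I"
        using ne[OF _ ev] by auto
      then show "eventually P (filtermap fst (tails I r))"
        unfolding eventually_filtermap eventually_tails[OF dir]
        by (rule rev_bexI) (auto simp: r_def I_def)
    next
      fix P assume "eventually P (filtermap fst (tails I r))"
      then obtain i where i: "i \<in> I" "\<forall>j\<in>I. r i j \<longrightarrow> P (fst j)"
        unfolding eventually_filtermap eventually_tails[OF dir] by blast
      have "P t" if "t \<in> snd i" for t
        using i that by (auto simp: I_def r_def)
      moreover have "eventually (\<lambda>t. t \<in> snd i) F"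
        using i(1) by (auto simp: I_def)
      ultimately show "eventually P F"
        by (auto elim!: eventually_mono)
    qed
    have "limitin (cube T) (\<lambda>i. eval_at T (fst i)) \<gamma> (tails I r)"
      using F(3) unfolding F_eq by (simp add: limitin_def eventually_filtermap)
    then have "(I, r, fst) \<in> ?N"
      using dir by (auto simp: I_def)
    then have "(INF i\<in>I. SUP j\<in>{j \<in> I. r i j}. f (fst j) z)
        \<le> (SUP (I, r, s)\<in>?N. INF i\<in>I. SUP j\<in>{j \<in> I. r i j}. f (s j) z)"
      by (rule SUP_upper2) simp
    moreover have "Limsup F (\<lambda>t. f t z) = (INF i\<in>I. SUP j\<in>{j \<in> I. r i j}. f (fst j) z)"
      unfolding F_eq Limsup_filtermap_eq by (rule Limsup_tails[OF dir])
    ultimately show "Limsup F (\<lambda>t. f t z)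
        \<le> (SUP (I, r, s)\<in>?N. INF i\<in>I. SUP j\<in>{j \<in> I. r i j}. f (s j) z)"
      by simp
  qed
qed

end

theory Submission
  imports Defs
begin

text \<open>A subgradient \<open>x\<^sup>*\<close> in the right-hand side satisfies the subgradient inequality at \<open>y\<close> because
  \<open>f\<^sub>\<gamma> \<le> f\<close>, with equality at \<open>x\<close> for active \<open>\<gamma>\<close>; take for \<open>L\<close> the span of \<open>x\<close> and \<open>y\<close>.

  Conversely let \<open>x\<^sup>* \<in> \<partial>f(x)\<close>, and on \<open>D = (L \<inter> dom f) - x\<close> put
  \<open>h\<^sub>\<gamma>(y) = f\<^sub>\<gamma>(x + y) - f(x) - \<langle>x\<^sup>*, y\<rangle>\<close>. Compactness of the extended index set gives for each
  \<open>y \<in> D\<close> an active \<open>\<gamma>\<close> with \<open>h\<^sub>\<gamma> \<ge> 0\<close> on the segment from \<open>0\<close> to \<open>y\<close>. If \<open>y\<close> is relatively interior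
  to \<open>D\<close>, then \<open>h\<^sub>\<gamma>\<close> has a subgradient at \<open>0\<close> that is nonnegative at \<open>y\<close>, so by separation \<open>0\<close> lies in
  the closure of the convex hull of all subgradients at \<open>0\<close>. By Caratheodory's theorem the convex
  combinations may be taken of bounded length, and upper semicontinuity in \<open>\<gamma>\<close> lets one pass to the
  limit, so the closure is not needed. All separation arguments, including the extension of functionals
  from \<open>L\<close> to the whole space, are instances of one form of the Hahn-Banach theorem.\<close>

section \<open>The Hahn-Banach theorem and dual bases\<close>

text \<open>Divide by the total weight; if it vanishes, any point of \<open>C\<close> serves. This
  makes the constraint cones built over convex sets below closed under addition.\<close>

lemma convex_scaled_add:
  assumes "convex C" "a \<in> C" "b \<in> C" "0 \<le> s" "0 \<le> t"
  obtains c where "c \<in> C" "(s + t) *\<^sub>R c = s *\<^sub>R a + t *\<^sub>R b"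
proof (cases "s + t = 0")
  case True
  then have "s = 0" "t = 0" using assms by auto
  then show ?thesis using that[of a] assms by simp
next
  case False
  then have "(s / (s + t)) *\<^sub>R a + (t / (s + t)) *\<^sub>R b \<in> C"
    using assms by (intro convexD) (simp_all flip: add_divide_distrib)
  then show ?thesis
    using False that by (auto simp: scaleR_add_right)
qed

text \<open>The pairs \<open>(d, r) \<in> S\<close> are constraints \<open>\<phi> d \<le> r\<close>. In a cone \<open>M \<supseteq> S\<close> that is maximal among the
  consistent ones every \<open>d\<close> has both its least bound and the opposite constraint at \<open>- d\<close>, so the
  least bound is linear in \<open>d\<close>.\<close>

lemma linear_minorant_of_cone:
  fixes S :: "('v::real_vector \<times> real) set"
  assumes add: "\<And>p q. p \<in> S \<Longrightarrow> q \<in> S \<Longrightarrow> p + q \<in> S"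
    and scale: "\<And>t p. 0 \<le> t \<Longrightarrow> p \<in> S \<Longrightarrow> t *\<^sub>R p \<in> S"
    and reach: "\<And>d. \<exists>r. (d, r) \<in> S"
    and pos: "\<And>r. (0, r) \<in> S \<Longrightarrow> 0 \<le> r"
  obtains \<phi> where "linear \<phi>" "\<And>d r. (d, r) \<in> S \<Longrightarrow> \<phi> d \<le> r"
proof -
  \<comment> \<open>The last clause is consistency: a constraint \<open>(0, r)\<close> with
    \<open>r < 0\<close> has no linear solution.\<close>
  define \<C> where "\<C> = {R. S \<subseteq> R \<and> (\<forall>p\<in>R. \<forall>q\<in>R. p + q \<in> R) \<and>
    (\<forall>t\<ge>0. \<forall>p\<in>R. t *\<^sub>R p \<in> R) \<and> (\<forall>r. (0, r) \<in> R \<longrightarrow> (0::real) \<le> r)}"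
  have \<C>I: "R \<in> \<C>" if "S \<subseteq> R" "\<And>p q. p \<in> R \<Longrightarrow> q \<in> R \<Longrightarrow> p + q \<in> R"
    "\<And>t p. 0 \<le> t \<Longrightarrow> p \<in> R \<Longrightarrow> t *\<^sub>R p \<in> R" "\<And>r. (0, r) \<in> R \<Longrightarrow> 0 \<le> r" for R
    using that unfolding \<C>_def by blast
  have \<C>D: "S \<subseteq> R" "\<And>p q. p \<in> R \<Longrightarrow> q \<in> R \<Longrightarrow> p + q \<in> R"
    "\<And>t p. 0 \<le> t \<Longrightarrow> p \<in> R \<Longrightarrow> t *\<^sub>R p \<in> R" "\<And>r. (0, r) \<in> R \<Longrightarrow> 0 \<le> r" if "R \<in> \<C>" for R
    using that unfolding \<C>_def by blast+
  have "\<exists>M\<in>\<C>. \<forall>X\<in>\<C>. M \<subseteq> X \<longrightarrow> X = M"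
  proof (rule subset_Zorn_nonempty)
    have "S \<in> \<C>"
      by (rule \<C>I) (fact subset_refl add scale pos)+
    then show "\<C> \<noteq> {}" by blast
  next
    fix \<K> assume \<K>: "\<K> \<noteq> {}" "subset.chain \<C> \<K>"
    then have sub: "\<And>R. R \<in> \<K> \<Longrightarrow> R \<in> \<C>" and lin: "\<And>P Q. P \<in> \<K> \<Longrightarrow> Q \<in> \<K> \<Longrightarrow> P \<subseteq> Q \<or> Q \<subseteq> P"
      by (auto simp: subset_chain_def)
    show "\<Union>\<K> \<in> \<C>"
    proof (rule \<C>I)
      show "S \<subseteq> \<Union>\<K>"
        using \<K>(1) \<C>D(1)[OF sub] by blast
    next
      fix p q assume "p \<in> \<Union>\<K>" "q \<in> \<Union>\<K>"
      then obtain R where "R \<in> \<K>" "p \<in> R" "q \<in> R"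
        using lin by blast
      then show "p + q \<in> \<Union>\<K>"
        using \<C>D(2)[OF sub] by blast
    next
      fix t p assume "(0::real) \<le> t" "p \<in> \<Union>\<K>"
      then show "t *\<^sub>R p \<in> \<Union>\<K>"
        using \<C>D(3)[OF sub] by blast
    next
      fix r assume "(0, r) \<in> \<Union>\<K>"
      then show "0 \<le> r"
        using \<C>D(4)[OF sub] by blast
    qed
  qed
  then obtain M where M: "M \<in> \<C>" and max: "\<And>X. X \<in> \<C> \<Longrightarrow> M \<subseteq> X \<Longrightarrow> X = M"
    by blast
  note SM = \<C>D(1)[OF M] and addM = \<C>D(2)[OF M] and scaleM = \<C>D(3)[OF M] and posM = \<C>D(4)[OF M]
  define \<phi> where "\<phi> d = Inf {r. (d, r) \<in> M}" for d
  have ne: "\<exists>r. (d, r) \<in> M" for d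
    using reach[of d] SM by blast
  have zero: "0 \<in> M"
    using ne[of 0] scaleM[of 0] by (auto simp: zero_prod_def)
  have opp: "0 \<le> r + r'" if "(d, r) \<in> M" "(- d, r') \<in> M" for d r r'
    using posM addM[OF that] by simp
  have bdd: "bdd_below {r. (d, r) \<in> M}" for d
  proof -
    obtain r' where "(- d, r') \<in> M"
      using ne by blast
    then have "- r' \<le> r" if "(d, r) \<in> M" for r
      using opp[OF that] by force
    then show ?thesis
      by (intro bdd_belowI) blast
  qed
  have lower: "\<phi> d \<le> r" if "(d, r) \<in> M" for d r
    unfolding \<phi>_def using bdd that by (intro cInf_lower) auto
  have greatest: "z \<le> \<phi> d" if "\<And>r. (d, r) \<in> M \<Longrightarrow> z \<le> r" for d z
    unfolding \<phi>_def using ne that by (intro cInf_greatest) auto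
  \<comment> \<open>Adjoin the ray through \<open>(- d, - \<phi> d)\<close> to \<open>M\<close>.
    Consistency survives because \<open>\<phi> d\<close> is below every bound of \<open>d\<close> in
    \<open>M\<close>, so by maximality the ray already lies in \<open>M\<close>.\<close>
  have neg_in: "(- d, - \<phi> d) \<in> M" for d
  proof -
    let ?n = "(- d, - \<phi> d)"
    define X where "X = {p + t *\<^sub>R ?n | p t. p \<in> M \<and> 0 \<le> t}"
    have XI: "p + t *\<^sub>R ?n \<in> X" if "p \<in> M" "0 \<le> t" for p t
      using that unfolding X_def by blast
    have MX: "M \<subseteq> X"
      using XI[of _ 0] by force
    have "X \<in> \<C>"
    proof (rule \<C>I)
      show "S \<subseteq> X"
        using SM MX by blast
    next
      fix p q assume "p \<in> X" "q \<in> X"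
      then obtain p' s q' t where pq: "p = p' + s *\<^sub>R ?n" "q = q' + t *\<^sub>R ?n"
        and in_M: "p' \<in> M" "q' \<in> M" "0 \<le> s" "0 \<le> t"
        unfolding X_def by blast
      have "p + q = (p' + q') + (s + t) *\<^sub>R ?n"
        unfolding pq scaleR_add_left by (simp only: add.assoc add.left_commute)
      then show "p + q \<in> X"
        using XI[OF addM[OF in_M(1,2)], of "s + t"] in_M by simp
    next
      fix u :: real and p assume "0 \<le> u" "p \<in> X"
      then obtain p' s where p: "p = p' + s *\<^sub>R ?n" "p' \<in> M" "0 \<le> s"
        unfolding X_def by blast
      have "u *\<^sub>R p = u *\<^sub>R p' + (u * s) *\<^sub>R ?n"
        unfolding p(1) by (simp only: scaleR_add_right scaleR_scaleR)
      then show "u *\<^sub>R p \<in> X"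
        using XI[OF scaleM[OF \<open>0 \<le> u\<close> p(2)], of "u * s"] p(3) \<open>0 \<le> u\<close> by simp
    next
      fix r assume "(0, r) \<in> X"
      then obtain p t where p: "(0, r) = p + t *\<^sub>R ?n" "p \<in> M" "0 \<le> t"
        unfolding X_def by blast
      from p(1) have "p = (0, r) - t *\<^sub>R ?n"
        by (simp only: eq_diff_eq)
      then have eq: "p = (t *\<^sub>R d, r + t * \<phi> d)"
        by simp
      show "0 \<le> r"
      proof (cases "t = 0")
        case True
        then show ?thesis using eq p(2) posM by simp
      next
        case False
        then have t: "t > 0" using p(3) by simp
        then have "inverse t *\<^sub>R p \<in> M" using p(2) by (intro scaleM) simp_all
        then have "\<phi> d \<le> inverse t * (r + t * \<phi> d)" using t eq by (intro lower) simp
        then show ?thesis using t by (simp add: field_simps)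
      qed
    qed
    then have "X = M" using MX by (rule max)
    then show ?thesis using XI[OF zero, of 1] by simp
  qed
  have in_M: "(d, \<phi> d) \<in> M" for d
  proof -
    have "- r \<le> \<phi> d" if "(- d, r) \<in> M" for r
      using opp[OF _ that] by (intro greatest) force
    then have "- \<phi> d \<le> \<phi> (- d)"
      by (intro greatest) force
    moreover have "\<phi> (- d) \<le> - \<phi> d" by (rule lower[OF neg_in])
    ultimately have "\<phi> (- d) = - \<phi> d" by (rule antisym[rotated])
    then show ?thesis using neg_in[of "- d"] by simp
  qed
  \<comment> \<open>A value constrained from both sides is the value of \<open>\<phi>\<close>.
    Linearity thus reduces to closure of \<open>M\<close> under sums and nonnegative multiples; a
    negative factor interchanges \<open>in_M\<close> and \<open>neg_in\<close>.\<close>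
  have graph: "\<phi> d = r" if "(d, r) \<in> M" "(- d, - r) \<in> M" for d r
    using lower[OF that(1)] opp[OF in_M[of d] that(2)] by simp
  have "linear \<phi>"
  proof (rule linearI)
    fix a b
    show "\<phi> (a + b) = \<phi> a + \<phi> b"
      using addM[OF in_M[of a] in_M[of b]] addM[OF neg_in[of a] neg_in[of b]]
      by (intro graph) simp_all
  next
    fix u :: real and a
    show "\<phi> (u *\<^sub>R a) = u *\<^sub>R \<phi> a"
    proof (cases "0 \<le> u")
      case True
      then show ?thesis
        using scaleM[OF _ in_M[of a], of u] scaleM[OF _ neg_in[of a], of u]
        by (intro graph) simp_all
    next
      case False
      then show ?thesis
        using scaleM[OF _ in_M[of a], of "- u"] scaleM[OF _ neg_in[of a], of "- u"]
        by (intro graph) simp_all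
    qed
  qed
  then show ?thesis
    using that lower SM by blast
qed

section \<open>Linear structure of the dual and continuity of linear functionals\<close>

lemma linear_dual_apply: "linear (dual_apply c)"
  using dual_apply[of c] by auto

lemma dual_apply_zero [simp]: "dual_apply 0 = (\<lambda>_. 0)"
  and dual_apply_plus [simp]: "dual_apply (c + c') = (\<lambda>y. dual_apply c y + dual_apply c' y)"
  and dual_apply_minus [simp]: "dual_apply (c - c') = (\<lambda>y. dual_apply c y - dual_apply c' y)"
  and dual_apply_scaleR [simp]: "dual_apply (r *\<^sub>R c) = (\<lambda>y. r * dual_apply c y)"
  by (transfer, simp)+

lemma dual_apply_sum [simp]: "dual_apply (sum g A) = (\<lambda>y. \<Sum>i\<in>A. dual_apply (g i) y)"
  by (induction A rule: infinite_finite_induct) auto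

lemmas dual_apply_linear_simps =
  linear_0[OF linear_dual_apply] linear_add[OF linear_dual_apply] linear_diff[OF linear_dual_apply]
  linear_scale[OF linear_dual_apply] linear_sum[OF linear_dual_apply]

lemma tendsto_scaleR_lcs:
  fixes g :: "'b \<Rightarrow> 'a::locally_convex_space"
  assumes "(r \<longlongrightarrow> a) F" "(g \<longlongrightarrow> l) F"
  shows "((\<lambda>y. r y *\<^sub>R g y) \<longlongrightarrow> a *\<^sub>R l) F"
proof -
  have "filterlim (\<lambda>y. (r y, g y)) (nhds a \<times>\<^sub>F nhds l) F"
    using assms by (rule filterlim_Pair)
  from filterlim_compose[OF tendsto_scaleR_Pair this] show ?thesis by simp
qed

lemma continuous_on_scaled_translate:
  fixes a :: "'a::locally_convex_space"
  shows "continuous_on UNIV (\<lambda>z. r *\<^sub>R (z - a))"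
  unfolding continuous_on_def by (auto intro!: tendsto_scaleR_lcs tendsto_intros)

text \<open>For points near \<open>a\<close>, the scaled difference and its negative both lie in
  \<open>V\<close>, which turns the one-sided bound into a two-sided one. The factor
  \<open>2 / e\<close> leaves \<open>e / 2\<close>, hence a strict inequality.\<close>

lemma linear_continuous_of_bounded_nhd:
  fixes \<phi> :: "'a::locally_convex_space \<Rightarrow> real"
  assumes "linear \<phi>" "open V" "0 \<in> V" and le: "\<And>v. v \<in> V \<Longrightarrow> \<phi> v \<le> 1"
  shows "continuous_on UNIV \<phi>"
proof -
  have "(\<phi> \<longlongrightarrow> \<phi> a) (at a)" for a
  proof (rule tendstoI)
    fix e :: real assume e: "e > 0"
    define U where "U = (\<lambda>z. (2 / e) *\<^sub>R (z - a)) -` V \<inter> (\<lambda>z. (- (2 / e)) *\<^sub>R (z - a)) -` V"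
    have "open U"
      unfolding U_def by (intro open_Int open_vimage \<open>open V\<close> continuous_on_scaled_translate)
    moreover have "a \<in> U"
      using \<open>0 \<in> V\<close> by (simp add: U_def)
    moreover have "dist (\<phi> z) (\<phi> a) < e" if "z \<in> U" for z
    proof -
      have "\<phi> ((2 / e) *\<^sub>R (z - a)) \<le> 1" "\<phi> ((- (2 / e)) *\<^sub>R (z - a)) \<le> 1"
        using that le by (auto simp: U_def)
      then have "(2 / e) * (\<phi> z - \<phi> a) \<le> 1" "(2 / e) * (\<phi> a - \<phi> z) \<le> 1"
        unfolding linear_scale[OF \<open>linear \<phi>\<close>] linear_diff[OF \<open>linear \<phi>\<close>]
        by (simp_all only: real_scaleR_def minus_diff_eq mult_minus_left flip: mult_minus_right)
      then have "2 * (\<phi> z - \<phi> a) \<le> e" "2 * (\<phi> a - \<phi> z) \<le> e"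
        using e by (auto simp: field_simps)
      then show ?thesis
        using e by (simp add: dist_real_def)
    qed
    ultimately show "\<forall>\<^sub>F z in at a. dist (\<phi> z) (\<phi> a) < e"
      unfolding eventually_at_topological by blast
  qed
  then show ?thesis
    by (simp add: continuous_on_def)
qed

text \<open>For a convex neighbourhood \<open>V\<close> of 0 missing \<open>v\<close>, ask for
  \<open>\<phi> \<le> 1\<close> on \<open>V\<close> and \<open>\<phi> (- v) \<le> - 1\<close>. The
  first condition gives continuity, the second a positive value at \<open>v\<close>, which is
  rescaled to 1.\<close>

lemma dual_separates_points:
  fixes v :: "'a::locally_convex_space"
  assumes "v \<noteq> 0"
  obtains c where "dual_apply c v = 1"
proof -
  have "open (- {v})" "0 \<in> - {v}"
    using assms by auto
  then obtain V where V: "open V" "convex V" "0 \<in> V" "v \<notin> V"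
    by (rule open_contains_convex_0) blast
  define S where "S = {(\<tau> *\<^sub>R u - s *\<^sub>R v, \<tau> - s) | \<tau> u s. 0 \<le> \<tau> \<and> 0 \<le> (s::real) \<and> u \<in> V}"
  have SI: "(d, r) \<in> S" if "d = \<tau> *\<^sub>R u - s *\<^sub>R v" "r = \<tau> - s" "0 \<le> \<tau>" "0 \<le> s" "u \<in> V" for d r \<tau> u s
    using that unfolding S_def by blast
  obtain \<phi> where \<phi>: "linear \<phi>" and le: "\<And>d r. (d, r) \<in> S \<Longrightarrow> \<phi> d \<le> r"
  proof (rule linear_minorant_of_cone[of S])
    fix p q assume "p \<in> S" "q \<in> S"
    then obtain \<tau> u s \<tau>' u' s' where
      p: "p = (\<tau> *\<^sub>R u - s *\<^sub>R v, \<tau> - s)" "0 \<le> \<tau>" "0 \<le> s" "u \<in> V" and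
      q: "q = (\<tau>' *\<^sub>R u' - s' *\<^sub>R v, \<tau>' - s')" "0 \<le> \<tau>'" "0 \<le> s'" "u' \<in> V"
      unfolding S_def by blast
    obtain u'' where u'': "u'' \<in> V" "(\<tau> + \<tau>') *\<^sub>R u'' = \<tau> *\<^sub>R u + \<tau>' *\<^sub>R u'"
      using convex_scaled_add[OF V(2) p(4) q(4) p(2) q(2)] .
    then show "p + q \<in> S"
      using p q unfolding p(1) q(1) add_Pair by (intro SI[of _ "\<tau> + \<tau>'" u'' "s + s'"]) (simp_all add: u'' scaleR_add_left)
  next
    fix t :: real and p assume "0 \<le> t" "p \<in> S"
    then obtain \<tau> u s where
      "p = (\<tau> *\<^sub>R u - s *\<^sub>R v, \<tau> - s)" "0 \<le> \<tau>" "0 \<le> s" "u \<in> V"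
      unfolding S_def by blast
    then show "t *\<^sub>R p \<in> S"
      using \<open>0 \<le> t\<close> by (simp, intro SI[of _ "t * \<tau>" u "t * s"]) (auto simp: algebra_simps)
  next
    fix d :: 'a
    have "((\<lambda>n. (1 / real (Suc n)) *\<^sub>R d) \<longlongrightarrow> 0 *\<^sub>R d) sequentially"
      by (rule tendsto_scaleR_lcs[OF _ tendsto_const])
        (use LIMSEQ_inverse_real_of_nat in \<open>simp add: inverse_eq_divide\<close>)
    then have "eventually (\<lambda>n. (1 / real (Suc n)) *\<^sub>R d \<in> V) sequentially"
      using V by (intro topological_tendstoD) auto
    then obtain n where "(1 / real (Suc n)) *\<^sub>R d \<in> V"
      using eventually_happens by fastforce
    then have "(d, real (Suc n)) \<in> S"
      by (intro SI[of _ "real (Suc n)" "(1 / real (Suc n)) *\<^sub>R d" 0]) auto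
    then show "\<exists>r. (d, r) \<in> S" ..
  next
    fix r assume "(0, r) \<in> S"
    then obtain \<tau> u s where h: "\<tau> *\<^sub>R u = s *\<^sub>R v" "r = \<tau> - s" "0 \<le> \<tau>" "0 \<le> s" "u \<in> V"
      unfolding S_def by auto
    show "0 \<le> r"
    proof (rule ccontr)
      assume "\<not> 0 \<le> r"
      \<comment> \<open>If \<open>\<tau> < s\<close>, then \<open>v\<close> lies on the segment from
        0 to \<open>u\<close>, hence in \<open>V\<close>.\<close>
      then have s: "\<tau> < s" using h by simp
      then have "v = (\<tau> / s) *\<^sub>R u"
        using arg_cong[OF h(1), of "scaleR (1 / s)"] h(3) s by simp
      moreover have "(\<tau> / s) *\<^sub>R u + (1 - \<tau> / s) *\<^sub>R 0 \<in> V"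
        using h s V by (intro convexD) auto
      ultimately show False using V(4) by simp
    qed
  qed blast
  have "(u, 1) \<in> S" if "u \<in> V" for u
    by (rule SI[of _ 1 u 0]) (use that in auto)
  then have "continuous_on UNIV \<phi>"
    using \<phi> V le by (intro linear_continuous_of_bounded_nhd[of _ V]) auto
  then have ap: "dual_apply (Abs_dual \<phi>) = \<phi>"
    using \<phi> by (simp add: Abs_dual_inverse)
  have "(- v, - 1) \<in> S"
    by (rule SI[of _ 0 0 1]) (use V in auto)
  then have "\<phi> v \<ge> 1"
    using le[of "- v" "- 1"] linear_neg[OF \<phi>, of v] by simp
  then have "dual_apply ((1 / \<phi> v) *\<^sub>R Abs_dual \<phi>) v = 1"
    by (simp add: ap)
  then show ?thesis by (rule that)
qed

text \<open>Induction on \<open>B\<close>. Subtract from the new vector \<open>b\<close> its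
  coordinates along \<open>B\<close>, take a functional equal to 1 on the remainder
  \<open>v\<close>, and correct it to vanish on \<open>B\<close>; then correct the old functionals
  to vanish at \<open>b\<close>.\<close>

lemma dual_basis_exists:
  fixes B :: "'a::locally_convex_space set"
  assumes "finite B" "independent B"
  shows "\<exists>e. \<forall>b\<in>B. \<forall>b'\<in>B. dual_apply (e b) b' = (if b = b' then 1 else 0)"
  using assms
proof (induction B rule: finite_induct)
  case (insert b B)
  then have "independent B" "b \<notin> span B"
    by (auto simp: independent_insert)
  with insert obtain e where e: "\<And>a a'. a \<in> B \<Longrightarrow> a' \<in> B \<Longrightarrow> dual_apply (e a) a' = (if a = a' then 1 else 0)"
    by blast
  define v where "v = b - (\<Sum>a\<in>B. dual_apply (e a) b *\<^sub>R a)"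
  have "(\<Sum>a\<in>B. dual_apply (e a) b *\<^sub>R a) \<in> span B"
    by (intro span_sum span_scale span_base)
  then have "v \<noteq> 0"
    using \<open>b \<notin> span B\<close> by (auto simp: v_def)
  then obtain h where h: "dual_apply h v = 1"
    by (rule dual_separates_points)
  define h' where "h' = h - (\<Sum>a\<in>B. dual_apply h a *\<^sub>R e a)"
  have h'B: "dual_apply h' a = 0" if "a \<in> B" for a
  proof -
    have "(\<Sum>a'\<in>B. dual_apply h a' * dual_apply (e a') a) = (\<Sum>a'\<in>B. if a' = a then dual_apply h a else 0)"
      using e that by (intro sum.cong) auto
    then show ?thesis
      using that insert(1) by (simp add: h'_def)
  qed
  have h'b: "dual_apply h' b = 1"
    using h by (simp add: h'_def v_def dual_apply_linear_simps mult.commute)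
  define e' where "e' a = (if a = b then h' else e a - dual_apply (e a) b *\<^sub>R h')" for a
  have "dual_apply (e' a) a' = (if a = a' then 1 else 0)" if "a \<in> insert b B" "a' \<in> insert b B" for a a'
    using that e h'B h'b insert(2) by (auto simp: e'_def)
  then show ?case by blast
qed auto

section \<open>Finite-dimensional preliminaries\<close>

text \<open>A representation with fewest points uses an affinely independent set, which inside
  \<open>span S\<close> has at most \<open>card S + 1\<close> points. A spanning set stands in for
  the dimension, as the ambient space may be infinite-dimensional.\<close>

lemma caratheodory_span:
  fixes W :: "'v::real_vector set"
  assumes S: "finite S" "W \<subseteq> span S" and x: "x \<in> convex hull W"
  obtains U u where "finite U" "U \<subseteq> W" "card U \<le> Suc (card S)" "\<And>v. v \<in> U \<Longrightarrow> 0 \<le> u v"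
    "sum u U = 1" "(\<Sum>v\<in>U. u v *\<^sub>R v) = x"
proof -
  define Q where "Q n \<longleftrightarrow> (\<exists>U u. finite U \<and> card U = n \<and> U \<subseteq> W \<and> (\<forall>v\<in>U. (0::real) \<le> u v) \<and>
    sum u U = 1 \<and> (\<Sum>v\<in>U. u v *\<^sub>R v) = x)" for n
  have "\<exists>n. Q n"
    using x unfolding convex_hull_explicit Q_def by blast
  then have Ql: "Q (LEAST n. Q n)" and least: "\<And>m. Q m \<Longrightarrow> (LEAST n. Q n) \<le> m"
    by (auto intro: LeastI_ex Least_le)
  then obtain U u where U: "finite U" "card U = (LEAST n. Q n)" "U \<subseteq> W" "\<And>v. v \<in> U \<Longrightarrow> 0 \<le> u v"
    "sum u U = 1" "(\<Sum>v\<in>U. u v *\<^sub>R v) = x"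
    unfolding Q_def by blast
  have min: "card U \<le> m" if "Q m" for m
    using least[OF that] U(2) by simp
  have "\<not> affine_dependent U"
  proof
    assume "affine_dependent U"
    then obtain w where w: "sum w U = 0" "\<exists>v\<in>U. w v \<noteq> 0" "(\<Sum>v\<in>U. w v *\<^sub>R v) = 0"
      using U(1) affine_dependent_explicit_finite by blast
    define I where "I = {v \<in> U. w v < 0}"
    have "I \<noteq> {}"
    proof
      assume "I = {}"
      then have "\<forall>v\<in>U. 0 \<le> w v" by (auto simp: I_def not_less)
      then show False using w(1,2) U(1) sum_nonneg_eq_0_iff by blast
    qed
    define t where "t = Min ((\<lambda>v. u v / (- w v)) ` I)"
    have "finite I" using U(1) by (simp add: I_def)
    have tle: "t \<le> u v / (- w v)" if "v \<in> I" for v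
      using that \<open>finite I\<close> unfolding t_def by (intro Min_le) auto
    have "t \<in> (\<lambda>v. u v / (- w v)) ` I"
      using \<open>I \<noteq> {}\<close> \<open>finite I\<close> unfolding t_def by (intro Min_in) auto
    then obtain a where a: "a \<in> I" "t = u a / (- w a)" by blast
    have aU: "a \<in> U" "w a < 0" using a(1) by (auto simp: I_def)
    have t0: "0 \<le> t" using a(2) aU U(4)[of a] by (simp add: divide_nonneg_neg)
    define u' where "u' v = u v + t * w v" for v
    have u'a: "u' a = 0" using a(2) aU by (simp add: u'_def)
    have u'0: "0 \<le> u' v" if "v \<in> U" for v
    proof (cases "w v < 0")
      case True
      then show ?thesis using tle[of v] that by (simp add: I_def u'_def field_simps)
    next
      case False
      then show ?thesis using t0 U(4)[OF that] by (simp add: u'_def)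
    qed
    have "sum u' U = 1"
      using w(1) U(5) by (simp add: u'_def sum.distrib flip: sum_distrib_left)
    then have s1: "sum u' (U - {a}) = 1"
      using u'a aU(1) U(1) by (simp add: sum.remove)
    have "(\<Sum>v\<in>U. u' v *\<^sub>R v) = x + t *\<^sub>R (\<Sum>v\<in>U. w v *\<^sub>R v)"
      using U(6) by (simp add: u'_def scaleR_add_left sum.distrib scaleR_sum_right)
    then have "(\<Sum>v\<in>U - {a}. u' v *\<^sub>R v) = x"
      using w(3) u'a aU(1) U(1) by (simp add: sum.remove)
    then have "Q (card (U - {a}))"
      using s1 U(1,3) u'0 unfolding Q_def by (intro exI[of _ "U - {a}"] exI[of _ u']) auto
    from min[OF this] show False
      using card_Diff1_less[OF U(1) aU(1)] by simp
  qed
  moreover obtain a where a: "a \<in> U"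
    using U(5) by force
  ultimately have "independent ((\<lambda>v. - a + v) ` (U - {a}))"
    using affine_dependent_iff_dependent2[OF a] by simp
  moreover have "(\<lambda>v. - a + v) ` (U - {a}) \<subseteq> span S"
    using a U(3) S(2) by (auto simp del: add_uminus_conv_diff uminus_add_conv_diff intro!: span_add span_neg)
  ultimately have "card ((\<lambda>v. - a + v) ` (U - {a})) \<le> card S"
    using independent_span_bound[OF S(1)] by blast
  moreover have "card ((\<lambda>v. - a + v) ` (U - {a})) = card U - 1"
    using a U(1) by (subst card_image) auto
  ultimately have "card U \<le> Suc (card S)" by simp
  with U that show ?thesis by blast
qed

text \<open>A fixed number of terms lets a sequence of convex combinations be treated index by
  index; missing terms are filled with a point of weight 0.\<close>

lemma caratheodory_span_indexed:
  fixes W :: "'v::real_vector set"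
  assumes "finite S" "W \<subseteq> span S" "x \<in> convex hull W"
  shows "\<exists>c l. (\<forall>i\<le>card S. c i \<in> W \<and> (0::real) \<le> l i) \<and> (\<Sum>i\<le>card S. l i) = 1 \<and>
    (\<Sum>i\<le>card S. l i *\<^sub>R c i) = x"
proof -
  obtain U u where U: "finite U" "U \<subseteq> W" "card U \<le> Suc (card S)" "\<And>v. v \<in> U \<Longrightarrow> 0 \<le> u v"
    "sum u U = 1" "(\<Sum>v\<in>U. u v *\<^sub>R v) = x"
    using caratheodory_span[OF assms] by blast
  obtain a where a: "a \<in> U" using U(5) by force
  obtain f where f: "bij_betw f {..<card U} U"
    using ex_bij_betw_nat_finite[OF U(1)] by (auto simp: atLeast0LessThan)
  define c where "c i = (if i < card U then f i else a)" for i
  define l where "l i = (if i < card U then u (f i) else 0)" for i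
  have fU: "f i \<in> U" if "i < card U" for i
    using f that by (auto simp: bij_betw_def)
  have sub: "{..<card U} \<subseteq> {..card S}" using U(3) by auto
  have "(\<Sum>i\<le>card S. l i) = (\<Sum>i<card U. u (f i))"
    by (intro sum.mono_neutral_cong_right) (use sub in \<open>auto simp: l_def\<close>)
  also have "\<dots> = 1"
    using sum.reindex_bij_betw[OF f, of u] U(5) by simp
  finally have "(\<Sum>i\<le>card S. l i) = 1" .
  moreover have "(\<Sum>i\<le>card S. l i *\<^sub>R c i) = (\<Sum>i<card U. u (f i) *\<^sub>R f i)"
    by (intro sum.mono_neutral_cong_right) (use sub in \<open>auto simp: l_def c_def\<close>)
  then have "(\<Sum>i\<le>card S. l i *\<^sub>R c i) = x"
    using sum.reindex_bij_betw[OF f, of "\<lambda>v. u v *\<^sub>R v"] U(6) by simp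
  moreover have "c i \<in> W \<and> 0 \<le> l i" for i
    using U(2,4) a fU by (auto simp: c_def l_def)
  ultimately show ?thesis
    by (intro exI[of _ c] exI[of _ l]) simp
qed

text \<open>Bolzano-Weierstrass once for each of the finitely many coordinates, each time thinning
  the previous subsequence.\<close>

lemma common_convergent_subsequence:
  fixes a :: "'j \<Rightarrow> nat \<Rightarrow> real"
  assumes "finite J" "\<And>j. j \<in> J \<Longrightarrow> bounded (range (a j))"
  obtains r l where "strict_mono (r :: nat \<Rightarrow> nat)" "\<And>j. j \<in> J \<Longrightarrow> (\<lambda>k. a j (r k)) \<longlonglongrightarrow> l j"
proof -
  have "\<exists>r::nat \<Rightarrow> nat. strict_mono r \<and> (\<forall>j\<in>J. convergent (\<lambda>k. a j (r k)))"
    using assms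
  proof (induction J rule: finite_induct)
    case empty
    then show ?case by (auto intro: strict_mono_id[unfolded id_def])
  next
    case (insert j J)
    then obtain r :: "nat \<Rightarrow> nat" where r: "strict_mono r" "\<forall>j\<in>J. convergent (\<lambda>k. a j (r k))"
      by auto
    have "bounded (range (\<lambda>k. a j (r k)))"
      using insert(4)[of j] by (rule bounded_subset) auto
    then obtain l s where s: "strict_mono (s::nat \<Rightarrow> nat)" "((\<lambda>k. a j (r k)) \<circ> s) \<longlonglongrightarrow> l"
      using bounded_imp_convergent_subsequence by blast
    have "convergent (\<lambda>k. a i (r (s k)))" if "i \<in> insert j J" for i
    proof (cases "i = j")
      case True
      then show ?thesis using s(2) by (auto simp: convergent_def o_def)
    next
      case False
      then show ?thesis
        using r(2) that convergent_subseq_convergent[OF _ s(1), of "\<lambda>k. a i (r k)"] by (auto simp: o_def)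
    qed
    then show ?case
      using strict_mono_o[OF r(1) s(1)] by (intro exI[of _ "r \<circ> s"]) (auto simp: o_def)
  qed
  then obtain r :: "nat \<Rightarrow> nat" where "strict_mono r" "\<forall>j\<in>J. convergent (\<lambda>k. a j (r k))"
    by blast
  then show ?thesis
    by (intro that[of r "\<lambda>j. lim (\<lambda>k. a j (r k))"]) (auto simp: convergent_LIMSEQ_iff)
qed

section \<open>Coordinates in a finite-dimensional subspace\<close>

locale dual_basis =
  fixes B :: "'a::locally_convex_space set" and e :: "'a \<Rightarrow> 'a dual"
  assumes finite_B: "finite B"
    and e: "\<And>b b'. b \<in> B \<Longrightarrow> b' \<in> B \<Longrightarrow> dual_apply (e b) b' = (if b = b' then 1 else 0)"
begin

text \<open>The projection onto \<open>span B\<close> along the common kernel of the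
  \<open>e b\<close>. Being defined on the whole space, it lets constraint cones for functionals on
  \<open>span B\<close> be stated there.\<close>

definition proj :: "'a \<Rightarrow> 'a" where
  "proj d = (\<Sum>b\<in>B. dual_apply (e b) d *\<^sub>R b)"

lemma proj_add: "proj (d + d') = proj d + proj d'"
  and proj_scaleR: "proj (r *\<^sub>R d) = r *\<^sub>R proj d"
  and proj_0 [simp]: "proj 0 = 0"
  by (simp_all add: proj_def dual_apply_linear_simps scaleR_add_left sum.distrib scaleR_sum_right)

lemma proj_in_span: "proj d \<in> span B"
  unfolding proj_def by (intro span_sum span_scale span_base)

lemma proj_id:
  assumes "y \<in> span B"
  shows "proj y = y"
proof -
  have "proj b = b" if "b \<in> B" for b
  proof -
    have "proj b = (\<Sum>b'\<in>B. if b' = b then b else 0)"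
      unfolding proj_def using e that by (intro sum.cong) auto
    then show ?thesis using that finite_B by simp
  qed
  moreover have "linear proj"
    by (intro linearI proj_add proj_scaleR)
  ultimately show ?thesis
    using linear_eq_on_span[of proj id B y] assms by (simp add: linear_id)
qed

text \<open>The functional with coordinates \<open>\<phi> b\<close> in the dual basis: a linear map
  becomes a continuous functional that agrees with it on \<open>span B\<close>.\<close>

definition extend :: "('a \<Rightarrow> real) \<Rightarrow> 'a dual" where
  "extend \<phi> = (\<Sum>b\<in>B. \<phi> b *\<^sub>R e b)"

lemma extend_in_span: "extend \<phi> \<in> span (e ` B)"
  unfolding extend_def by (intro span_sum span_scale span_base) auto

lemma dual_apply_extend:
  assumes "linear \<phi>" "y \<in> span B"
  shows "dual_apply (extend \<phi>) y = \<phi> y"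
proof -
  have "dual_apply (extend \<phi>) y = \<phi> (proj y)"
    unfolding extend_def proj_def linear_sum[OF assms(1)] linear_scale[OF assms(1)]
    by (simp add: mult.commute)
  then show ?thesis using proj_id[OF assms(2)] by simp
qed

lemma extend_dual_apply:
  assumes "c \<in> span (e ` B)"
  shows "extend (dual_apply c) = c"
proof -
  have "extend (dual_apply (e b)) = e b" if "b \<in> B" for b
  proof -
    have "extend (dual_apply (e b)) = (\<Sum>b'\<in>B. if b' = b then e b else 0)"
      unfolding extend_def using e that by (intro sum.cong) auto
    then show ?thesis using that finite_B by simp
  qed
  moreover have "linear (\<lambda>c. extend (dual_apply c))"
    by (intro linearI) (simp_all add: extend_def scaleR_add_left sum.distrib scaleR_sum_right)
  ultimately show ?thesis
    using linear_eq_on_span[of "\<lambda>c. extend (dual_apply c)" id "e ` B" c] assms by (auto simp: linear_id)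
qed

end

section \<open>Subgradients and normals on a finite-dimensional convex set\<close>

text \<open>\<open>B\<close> is a basis of the span of \<open>D\<close> chosen inside
  \<open>D\<close>. Thus \<open>D\<close> contains the simplex with vertices 0 and \<open>B\<close>,
  which supplies internal points.\<close>

locale convex_with_basis = dual_basis +
  fixes D :: "'a set"
  assumes convex_D: "convex D" and zero_D: "0 \<in> D" and B_D: "B \<subseteq> D" and D_span: "D \<subseteq> span B"
begin

text \<open>The algebraic interior of \<open>D\<close> relative to \<open>span B\<close>.\<close>

definition internal :: "'a \<Rightarrow> bool" where
  "internal w \<longleftrightarrow> w \<in> D \<and> (\<forall>d\<in>span B. \<exists>\<epsilon>>0. w + \<epsilon> *\<^sub>R d \<in> D)"

lemma internal_in: "internal w \<Longrightarrow> w \<in> D"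
  by (simp add: internal_def)

lemma scale_in: "y \<in> D \<Longrightarrow> 0 \<le> t \<Longrightarrow> t \<le> 1 \<Longrightarrow> t *\<^sub>R y \<in> D"
  using convexD[OF convex_D _ zero_D, of y t "1 - t"] by simp

lemma subconvex_sum_in:
  assumes "\<And>b. b \<in> B \<Longrightarrow> 0 \<le> a b" "sum a B \<le> 1"
  shows "(\<Sum>b\<in>B. a b *\<^sub>R b) \<in> D"
proof (cases "sum a B = 0")
  case True
  then have "\<forall>b\<in>B. a b = 0"
    using assms(1) finite_B sum_nonneg_eq_0_iff by blast
  then show ?thesis using zero_D by simp
next
  case False
  have pos: "0 \<le> sum a B"
    using assms(1) by (rule sum_nonneg)
  then have "(\<Sum>b\<in>B. (a b / sum a B) *\<^sub>R b) \<in> D"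
    using False assms(1) B_D finite_B convex_D
    by (intro convex_sum) (auto simp flip: sum_divide_distrib)
  then have "sum a B *\<^sub>R (\<Sum>b\<in>B. (a b / sum a B) *\<^sub>R b) \<in> D"
    using pos assms(2) by (rule scale_in)
  then show ?thesis
    using False by (simp add: scaleR_sum_right)
qed

text \<open>The barycentre of the simplex with vertices 0 and \<open>B\<close>. A small multiple of
  \<open>d\<close> lowers no weight on \<open>B\<close> by more than \<open>1 / N\<close>, and the
  weight \<open>1 / N\<close> left at 0 absorbs the change of their sum.\<close>

lemma ex_internal: "\<exists>w. internal w"
proof -
  define N where "N = real (Suc (card B))"
  have N: "0 < N" "real (card B) = N - 1" by (simp_all add: N_def)
  define w where "w = (\<Sum>b\<in>B. (1 / N) *\<^sub>R b)"
  have "w \<in> D"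
    unfolding w_def using N by (intro subconvex_sum_in) (auto simp: field_simps)
  moreover have "\<exists>\<epsilon>>0. w + \<epsilon> *\<^sub>R d \<in> D" if "d \<in> span B" for d
  proof -
    define s where "s = (\<Sum>b\<in>B. \<bar>dual_apply (e b) d\<bar>)"
    have s: "0 \<le> s" unfolding s_def by (intro sum_nonneg) simp
    define \<epsilon> where "\<epsilon> = 1 / (N * (1 + s))"
    have \<epsilon>: "0 < \<epsilon>" using N s by (simp add: \<epsilon>_def)
    have "\<epsilon> * s = (1 / N) * (s / (1 + s))"
      by (simp add: \<epsilon>_def)
    also have "\<dots> \<le> (1 / N) * 1"
      using N s by (intro mult_left_mono) auto
    finally have \<epsilon>s: "\<epsilon> * s \<le> 1 / N" by simp
    have "0 \<le> 1 / N + \<epsilon> * dual_apply (e b) d" if "b \<in> B" for b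
    proof -
      have "\<bar>dual_apply (e b) d\<bar> \<le> s"
        unfolding s_def using that finite_B by (intro member_le_sum) auto
      then have "\<epsilon> * \<bar>dual_apply (e b) d\<bar> \<le> \<epsilon> * s"
        using \<epsilon> by (intro mult_left_mono) auto
      moreover have "- (\<epsilon> * \<bar>dual_apply (e b) d\<bar>) \<le> \<epsilon> * dual_apply (e b) d"
        using \<epsilon> mult_left_mono[of "- \<bar>dual_apply (e b) d\<bar>" "dual_apply (e b) d" \<epsilon>] by simp
      ultimately show ?thesis using \<epsilon>s by linarith
    qed
    moreover have "(\<Sum>b\<in>B. 1 / N + \<epsilon> * dual_apply (e b) d) \<le> 1"
    proof -
      have "(\<Sum>b\<in>B. dual_apply (e b) d) \<le> s"
        unfolding s_def by (intro sum_mono) simp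
      then have "\<epsilon> * (\<Sum>b\<in>B. dual_apply (e b) d) \<le> 1 / N"
        using \<epsilon>s \<epsilon> mult_left_mono[of "\<Sum>b\<in>B. dual_apply (e b) d" s \<epsilon>] by linarith
      moreover have "(\<Sum>b\<in>B. 1 / N) = 1 - 1 / N"
        using N by (simp add: field_simps)
      ultimately show ?thesis
        by (simp add: sum.distrib sum_distrib_left)
    qed
    ultimately have "(\<Sum>b\<in>B. (1 / N + \<epsilon> * dual_apply (e b) d) *\<^sub>R b) \<in> D"
      by (rule subconvex_sum_in)
    moreover have "w + \<epsilon> *\<^sub>R proj d = (\<Sum>b\<in>B. (1 / N + \<epsilon> * dual_apply (e b) d) *\<^sub>R b)"
      by (simp add: w_def proj_def scaleR_add_left sum.distrib scaleR_sum_right)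
    ultimately show ?thesis
      using \<epsilon> proj_id[OF that] by auto
  qed
  ultimately show ?thesis unfolding internal_def by blast
qed

lemma internal_mix:
  assumes a: "a \<in> D" and w: "internal w" and \<mu>: "0 < \<mu>" "\<mu> \<le> 1"
  shows "internal ((1 - \<mu>) *\<^sub>R a + \<mu> *\<^sub>R w)"
  unfolding internal_def
proof (intro conjI ballI)
  show "(1 - \<mu>) *\<^sub>R a + \<mu> *\<^sub>R w \<in> D"
    using a internal_in[OF w] \<mu> by (intro convexD[OF convex_D]) auto
  fix d assume "d \<in> span B"
  then obtain \<epsilon> where \<epsilon>: "\<epsilon> > 0" "w + \<epsilon> *\<^sub>R d \<in> D"
    using w unfolding internal_def by blast
  then have "(1 - \<mu>) *\<^sub>R a + \<mu> *\<^sub>R (w + \<epsilon> *\<^sub>R d) \<in> D"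
    using a \<mu> by (intro convexD[OF convex_D]) auto
  then show "\<exists>\<epsilon>>0. (1 - \<mu>) *\<^sub>R a + \<mu> *\<^sub>R w + \<epsilon> *\<^sub>R d \<in> D"
    using \<epsilon> \<mu> by (intro exI[of _ "\<mu> * \<epsilon>"]) (simp add: scaleR_add_right add.assoc)
qed

text \<open>The minorant must lie below the epigraph of \<open>h\<close> and be nonpositive at
  \<open>- w\<close>. Only epigraph points over the ray through \<open>w\<close> could make this
  inconsistent, and there \<open>h\<close> is nonnegative.\<close>

lemma ex_subgradient_at_internal:
  fixes h :: "'a \<Rightarrow> ereal" and M :: "'a \<Rightarrow> real"
  assumes conv: "convex {(y, q). y \<in> D \<and> h y \<le> ereal q}"
    and bound: "\<And>y. y \<in> D \<Longrightarrow> h y \<le> ereal (M y)" and zero: "h 0 = 0"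
    and w: "internal w" and nonneg: "\<And>s. 0 < s \<Longrightarrow> s \<le> 1 \<Longrightarrow> 0 \<le> h (s *\<^sub>R w)"
  obtains c where "c \<in> span (e ` B)" "\<And>y. y \<in> D \<Longrightarrow> ereal (dual_apply c y) \<le> h y" "0 \<le> dual_apply c w"
proof -
  define E where "E = {(y, q). y \<in> D \<and> h y \<le> ereal q}"
  define S where "S = {(d, r). \<exists>\<tau> s p. 0 \<le> \<tau> \<and> 0 \<le> (s::real) \<and> p \<in> E \<and>
    proj d = \<tau> *\<^sub>R fst p - s *\<^sub>R w \<and> r = \<tau> * snd p}"
  have SI: "(d, r) \<in> S" if "proj d = \<tau> *\<^sub>R fst p - s *\<^sub>R w" "r = \<tau> * snd p" "0 \<le> \<tau>" "0 \<le> s" "p \<in> E" for d r \<tau> s p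
    using that unfolding S_def by blast
  have E0: "(0, 0) \<in> E" using zero_D zero by (simp add: E_def)
  obtain \<phi> where \<phi>: "linear \<phi>" and le: "\<And>d r. (d, r) \<in> S \<Longrightarrow> \<phi> d \<le> r"
  proof (rule linear_minorant_of_cone[of S])
    fix x x' assume "x \<in> S" "x' \<in> S"
    then obtain d r \<tau> s p d' r' \<tau>' s' p' where x: "x = (d, r)" "0 \<le> \<tau>" "0 \<le> s" "p \<in> E"
       "proj d = \<tau> *\<^sub>R fst p - s *\<^sub>R w" "r = \<tau> * snd p" and
      x': "x' = (d', r')" "0 \<le> \<tau>'" "0 \<le> s'" "p' \<in> E"
       "proj d' = \<tau>' *\<^sub>R fst p' - s' *\<^sub>R w" "r' = \<tau>' * snd p'"
      unfolding S_def by blast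
    obtain p'' where p'': "p'' \<in> E" "(\<tau> + \<tau>') *\<^sub>R p'' = \<tau> *\<^sub>R p + \<tau>' *\<^sub>R p'"
      using convex_scaled_add[OF conv[folded E_def] x(4) x'(4) x(2) x'(2)] .
    have f: "(\<tau> + \<tau>') *\<^sub>R fst p'' = \<tau> *\<^sub>R fst p + \<tau>' *\<^sub>R fst p'"
      using arg_cong[OF p''(2), of fst] by simp
    have s: "(\<tau> + \<tau>') * snd p'' = \<tau> * snd p + \<tau>' * snd p'"
      using arg_cong[OF p''(2), of snd] by simp
    have sum1: "proj (d + d') = (\<tau> + \<tau>') *\<^sub>R fst p'' - (s + s') *\<^sub>R w"
      unfolding proj_add x(5) x'(5) f by (simp add: scaleR_add_left)
    have sum2: "r + r' = (\<tau> + \<tau>') * snd p''"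
      unfolding s x(6) x'(6) ..
    show "x + x' \<in> S"
      unfolding x(1) x'(1) add_Pair
      by (rule SI[OF sum1 sum2]) (use x(2,3) x'(2,3) p''(1) in simp_all)
  next
    fix t :: real and x assume "0 \<le> t" "x \<in> S"
    then obtain d r \<tau> s p where x: "x = (d, r)" "0 \<le> \<tau>" "0 \<le> s" "p \<in> E"
       "proj d = \<tau> *\<^sub>R fst p - s *\<^sub>R w" "r = \<tau> * snd p"
      unfolding S_def by blast
    then show "t *\<^sub>R x \<in> S"
      using \<open>0 \<le> t\<close> unfolding x(1) scaleR_Pair
      by (intro SI[of _ "t * \<tau>" p "t * s"]) (simp_all add: proj_scaleR scaleR_diff_right)
  next
    fix d
    \<comment> \<open>Internality makes every projected direction a quotient
      \<open>(y - w) / \<epsilon>\<close> with \<open>y\<close> in \<open>D\<close>, so that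
      \<open>M y / \<epsilon>\<close> is a bound for \<open>d\<close>.\<close>
    obtain \<epsilon> where \<epsilon>: "\<epsilon> > 0" "w + \<epsilon> *\<^sub>R proj d \<in> D"
      using w proj_in_span unfolding internal_def by blast
    define y where "y = w + \<epsilon> *\<^sub>R proj d"
    have "(y, M y) \<in> E" using \<epsilon> bound by (simp add: E_def y_def)
    then have "(d, (1 / \<epsilon>) * M y) \<in> S"
      using \<epsilon>(1) by (intro SI[of _ "1 / \<epsilon>" "(y, M y)" "1 / \<epsilon>"]) (simp_all add: y_def scaleR_add_right)
    then show "\<exists>r. (d, r) \<in> S" ..
  next
    fix r assume "(0, r) \<in> S"
    then obtain \<tau> s p where "0 \<le> \<tau>" "0 \<le> s" "p \<in> E" "\<tau> *\<^sub>R fst p = s *\<^sub>R w" "r = \<tau> * snd p"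
      unfolding S_def by auto
    moreover obtain y q where "p = (y, q)" by (cases p)
    ultimately have h: "0 \<le> \<tau>" "0 \<le> s" "y \<in> D" "h y \<le> ereal q" "\<tau> *\<^sub>R y = s *\<^sub>R w" "r = \<tau> * q"
      by (auto simp: E_def)
    show "0 \<le> r"
    proof (cases "\<tau> = 0")
      case False
      define \<alpha> where "\<alpha> = s / \<tau>"
      have \<tau>: "\<tau> > 0" using False h by simp
      have y: "y = \<alpha> *\<^sub>R w"
        using arg_cong[OF h(5), of "scaleR (1 / \<tau>)"] \<tau> by (simp add: \<alpha>_def del: h(5))
      have "0 \<le> \<alpha>" using h \<tau> by (simp add: \<alpha>_def)
      \<comment> \<open>For \<open>1 < \<alpha>\<close> the point \<open>w\<close> lies between 0
        and \<open>y\<close>, and convexity with \<open>h 0 = 0\<close> carries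
        \<open>0 \<le> h w\<close> over to \<open>q\<close>.\<close>
      then consider "\<alpha> = 0" | "0 < \<alpha>" "\<alpha> \<le> 1" | "1 < \<alpha>" by linarith
      then have "0 \<le> q"
      proof cases
        case 1
        then show ?thesis using h(4) zero y by simp
      next
        case 2
        have "0 \<le> ereal q" using nonneg[OF 2] h(4) unfolding y by (rule order_trans)
        then show ?thesis by simp
      next
        case 3
        have "(y, q) \<in> E" using h(3,4) by (simp add: E_def)
        then have "(1 / \<alpha>) *\<^sub>R (y, q) + (1 - 1 / \<alpha>) *\<^sub>R (0, 0) \<in> E"
          using 3 by (intro convexD[OF conv[folded E_def]] E0) auto
        then have "h w \<le> ereal (q / \<alpha>)"
          using 3 y by (simp add: E_def)
        moreover have "0 \<le> h w" using nonneg[of 1] by simp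
        ultimately have "0 \<le> ereal (q / \<alpha>)" by (rule order_trans[rotated])
        then show ?thesis using 3 by (simp add: zero_le_divide_iff)
      qed
      then show ?thesis using h \<tau> by simp
    qed (use h in simp)
  qed blast
  have ext: "dual_apply (extend \<phi>) y = \<phi> y" if "y \<in> D" for y
    using dual_apply_extend[OF \<phi>] that D_span by blast
  show ?thesis
  proof (rule that[of "extend \<phi>"])
    show "extend \<phi> \<in> span (e ` B)" by (rule extend_in_span)
    show "ereal (dual_apply (extend \<phi>) y) \<le> h y" if "y \<in> D" for y
    proof (rule ereal_le_real)
      fix q assume "h y \<le> ereal q"
      then have "(y, q) \<in> S"
        using that D_span by (intro SI[of _ 1 "(y, q)" 0]) (auto simp: E_def proj_id)
      then show "ereal (dual_apply (extend \<phi>) y) \<le> ereal q"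
        using le ext[OF that] by simp
    qed
    have wD: "w \<in> D" using w by (rule internal_in)
    then have "(- 1) *\<^sub>R w \<in> span B" using D_span by (auto intro: span_scale span_neg)
    then have "((- 1) *\<^sub>R w, 0) \<in> S"
      using E0 by (intro SI[of _ 0 "(0, 0)" 1]) (simp_all add: proj_id)
    from le[OF this] show "0 \<le> dual_apply (extend \<phi>) w"
      using ext[OF wD] linear_scale[OF \<phi>, of "- 1" w] by simp
  qed
qed

text \<open>Separates the ray through \<open>v\<close> from the internal points of \<open>D\<close>;
  the result is normal to \<open>D\<close> at 0. The bound at \<open>w\<close> makes a perturbation
  of \<open>v\<close> along \<open>w\<close> yield a strict inequality.\<close>

lemma ex_separating_functional:
  assumes w: "internal w" and v: "v \<in> span B" and out: "\<And>\<alpha>. 0 < \<alpha> \<Longrightarrow> \<alpha> *\<^sub>R v \<notin> D"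
  obtains n where "n \<in> span (e ` B)" "\<And>y. y \<in> D \<Longrightarrow> dual_apply n y \<le> 0"
    "0 \<le> dual_apply n v" "dual_apply n w \<le> - 1"
proof -
  \<comment> \<open>The bound \<open>\<sigma>\<close> is also the coefficient of \<open>w\<close>:
    the cone contains \<open>(y, 0)\<close> for \<open>y\<close> in \<open>D\<close>,
    \<open>(- v, 0)\<close> and \<open>(w, - 1)\<close>.\<close>
  define S where "S = {(d, \<sigma>). \<exists>\<tau> s y. 0 \<le> \<tau> \<and> 0 \<le> (s::real) \<and> y \<in> D \<and>
    proj d = \<tau> *\<^sub>R y - s *\<^sub>R v - \<sigma> *\<^sub>R w}"
  have SI: "(d, \<sigma>) \<in> S" if "proj d = \<tau> *\<^sub>R y - s *\<^sub>R v - \<sigma> *\<^sub>R w" "0 \<le> \<tau>" "0 \<le> s" "y \<in> D" for d \<sigma> \<tau> s y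
    using that unfolding S_def by blast
  have wD: "w \<in> D" using w by (rule internal_in)
  obtain \<phi> where \<phi>: "linear \<phi>" and le: "\<And>d r. (d, r) \<in> S \<Longrightarrow> \<phi> d \<le> r"
  proof (rule linear_minorant_of_cone[of S])
    fix x x' assume "x \<in> S" "x' \<in> S"
    then obtain d \<sigma> \<tau> s y d' \<sigma>' \<tau>' s' y' where x: "x = (d, \<sigma>)" "0 \<le> \<tau>" "0 \<le> s" "y \<in> D"
       "proj d = \<tau> *\<^sub>R y - s *\<^sub>R v - \<sigma> *\<^sub>R w" and
      x': "x' = (d', \<sigma>')" "0 \<le> \<tau>'" "0 \<le> s'" "y' \<in> D"
       "proj d' = \<tau>' *\<^sub>R y' - s' *\<^sub>R v - \<sigma>' *\<^sub>R w"
      unfolding S_def by blast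
    obtain y'' where y'': "y'' \<in> D" "(\<tau> + \<tau>') *\<^sub>R y'' = \<tau> *\<^sub>R y + \<tau>' *\<^sub>R y'"
      using convex_scaled_add[OF convex_D x(4) x'(4) x(2) x'(2)] .
    have sum1: "proj (d + d') = (\<tau> + \<tau>') *\<^sub>R y'' - (s + s') *\<^sub>R v - (\<sigma> + \<sigma>') *\<^sub>R w"
      unfolding proj_add x(5) x'(5) y''(2) by (simp add: scaleR_add_left)
    show "x + x' \<in> S"
      unfolding x(1) x'(1) add_Pair
      by (rule SI[OF sum1]) (use x(2,3) x'(2,3) y''(1) in simp_all)
  next
    fix t :: real and x assume "0 \<le> t" "x \<in> S"
    then obtain d \<sigma> \<tau> s y where x: "x = (d, \<sigma>)" "0 \<le> \<tau>" "0 \<le> s" "y \<in> D"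
       "proj d = \<tau> *\<^sub>R y - s *\<^sub>R v - \<sigma> *\<^sub>R w"
      unfolding S_def by blast
    then show "t *\<^sub>R x \<in> S"
      using \<open>0 \<le> t\<close> unfolding x(1) scaleR_Pair
      by (intro SI[of _ "t * \<tau>" y "t * s"]) (simp_all add: proj_scaleR scaleR_diff_right)
  next
    fix d
    obtain \<epsilon> where \<epsilon>: "\<epsilon> > 0" "w + \<epsilon> *\<^sub>R proj d \<in> D"
      using w proj_in_span unfolding internal_def by blast
    then have "(d, 1 / \<epsilon>) \<in> S"
      by (intro SI[of _ "1 / \<epsilon>" "w + \<epsilon> *\<^sub>R proj d" 0]) (simp_all add: scaleR_add_right)
    then show "\<exists>r. (d, r) \<in> S" ..
  next
    fix \<sigma> assume "(0, \<sigma>) \<in> S"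
    then obtain \<tau> s y where h: "0 \<le> \<tau>" "0 \<le> s" "y \<in> D" "0 = \<tau> *\<^sub>R y - s *\<^sub>R v - \<sigma> *\<^sub>R w"
      unfolding S_def by auto
    show "0 \<le> \<sigma>"
    proof (rule ccontr)
      assume "\<not> 0 \<le> \<sigma>"
      then have \<sigma>: "\<sigma> < 0" by simp
      \<comment> \<open>For \<open>\<sigma> < 0\<close> the relation makes a positive multiple of
        the internal point \<open>y'\<close> equal to \<open>s\<close> times \<open>v\<close>.
        Either \<open>s > 0\<close> and a positive multiple of \<open>v\<close> lies in
        \<open>D\<close>, or 0 is internal and again some positive multiple does.\<close>
      define \<mu> where "\<mu> = - \<sigma> / (\<tau> - \<sigma>)"
      define y' where "y' = (1 - \<mu>) *\<^sub>R y + \<mu> *\<^sub>R w"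
      have \<mu>: "0 < \<mu>" "\<mu> \<le> 1" using \<sigma> h(1) by (simp_all add: \<mu>_def field_simps)
      have y': "internal y'" unfolding y'_def using h(3) w \<mu> by (rule internal_mix)
      have m: "(\<tau> - \<sigma>) * \<mu> = - \<sigma>" "(\<tau> - \<sigma>) * (1 - \<mu>) = \<tau>"
        using \<sigma> h(1) by (simp_all add: \<mu>_def field_simps)
      have "(\<tau> - \<sigma>) *\<^sub>R y' = \<tau> *\<^sub>R y - \<sigma> *\<^sub>R w"
        unfolding y'_def scaleR_add_right scaleR_scaleR m by simp
      also have "\<dots> = s *\<^sub>R v"
        using h(4) by (simp add: algebra_simps)
      finally have eq: "(\<tau> - \<sigma>) *\<^sub>R y' = s *\<^sub>R v" .
      have y'eq: "y' = (s / (\<tau> - \<sigma>)) *\<^sub>R v"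
        using arg_cong[OF eq, of "scaleR (1 / (\<tau> - \<sigma>))"] \<sigma> h(1) by simp
      show False
      proof (cases "s = 0")
        case True
        then have "internal 0" using y' y'eq by simp
        then show False using v out unfolding internal_def by force
      next
        case False
        then have "0 < s / (\<tau> - \<sigma>)" using \<sigma> h(1,2) by simp
        then show False using out internal_in[OF y'] y'eq by simp
      qed
    qed
  qed blast
  have ext: "dual_apply (extend \<phi>) y = \<phi> y" if "y \<in> span B" for y
    using dual_apply_extend[OF \<phi> that] .
  show ?thesis
  proof (rule that[of "extend \<phi>"])
    show "extend \<phi> \<in> span (e ` B)" by (rule extend_in_span)
    show "dual_apply (extend \<phi>) y \<le> 0" if "y \<in> D" for y
    proof -
      have "(y, 0) \<in> S"
        using that D_span by (intro SI[of _ 1 y 0]) (auto simp: proj_id)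
      then show ?thesis using le ext that D_span by auto
    qed
    have "(- 1) *\<^sub>R v \<in> span B" using v by (rule span_scale)
    then have "((- 1) *\<^sub>R v, 0) \<in> S"
      using zero_D by (intro SI[of _ 0 0 1]) (simp_all add: proj_id)
    from le[OF this] show "0 \<le> dual_apply (extend \<phi>) v"
      using ext[OF v] linear_scale[OF \<phi>, of "- 1" v] by simp
    have "w \<in> span B" using wD D_span by blast
    then have "(w, - 1) \<in> S"
      using zero_D by (intro SI[of _ 0 0 0]) (simp_all add: proj_id)
    from le[OF this] show "dual_apply (extend \<phi>) w \<le> - 1"
      using ext[OF \<open>w \<in> span B\<close>] by simp
  qed
qed

end

section \<open>Families of convex functions\<close>

text \<open>\<open>G\<close> stands for the active indices. \<open>cluster\<close> is compactness
  with upper semicontinuity: one index inherits the eventual lower bounds at all points. It asks for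
  no convergent subsequence, since a compact space need not be sequentially compact.\<close>

locale active_convex_family = convex_with_basis +
  fixes G :: "'g set" and h :: "'g \<Rightarrow> 'a \<Rightarrow> ereal" and M :: "'a \<Rightarrow> real"
  assumes conv: "g \<in> G \<Longrightarrow> convex {(y, q). y \<in> D \<and> h g y \<le> ereal q}"
    and bound: "g \<in> G \<Longrightarrow> y \<in> D \<Longrightarrow> h g y \<le> ereal (M y)"
    and zero: "g \<in> G \<Longrightarrow> h g 0 = 0"
    and active: "y \<in> D \<Longrightarrow> \<exists>g\<in>G. \<forall>s. 0 < s \<longrightarrow> s \<le> 1 \<longrightarrow> 0 \<le> h g (s *\<^sub>R y)"
    and cluster: "(\<And>k::nat. gs k \<in> G) \<Longrightarrow> \<exists>g\<in>G. \<forall>y\<in>D. \<forall>r.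
      (\<forall>\<^sub>F k in sequentially. ereal r < h (gs k) y) \<longrightarrow> ereal r \<le> h g y"
begin

text \<open>As \<open>h g 0 = 0\<close>, these are subgradients at 0 relative to \<open>D\<close>.
  The span of the \<open>e b\<close> holds one representative of each functional on
  \<open>span B\<close> and is finite-dimensional, so Caratheodory's theorem applies.\<close>

definition subgradients :: "'g \<Rightarrow> 'a dual set" where
  "subgradients g = {c \<in> span (e ` B). \<forall>y\<in>D. ereal (dual_apply c y) \<le> h g y}"

definition all_subgradients :: "'a dual set" where
  "all_subgradients = (\<Union>g\<in>G. subgradients g)"

lemma all_subgradients_bound:
  assumes "c \<in> all_subgradients" "y \<in> D"
  shows "dual_apply c y \<le> M y"
proof -
  obtain g where "g \<in> G" "ereal (dual_apply c y) \<le> h g y"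
    using assms by (auto simp: all_subgradients_def subgradients_def)
  then have "ereal (dual_apply c y) \<le> ereal (M y)"
    using bound assms(2) order_trans by blast
  then show ?thesis by simp
qed

lemma ex_subgradient_nonneg:
  assumes "internal w"
  shows "\<exists>c\<in>all_subgradients. 0 \<le> dual_apply c w"
proof -
  obtain g where g: "g \<in> G" "\<And>s. 0 < s \<Longrightarrow> s \<le> 1 \<Longrightarrow> 0 \<le> h g (s *\<^sub>R w)"
    using active internal_in[OF assms] by blast
  obtain c where "c \<in> span (e ` B)" "\<And>y. y \<in> D \<Longrightarrow> ereal (dual_apply c y) \<le> h g y" "0 \<le> dual_apply c w"
    using ex_subgradient_at_internal[OF conv[OF g(1)] bound[OF g(1)] zero[OF g(1)] assms g(2)] by blast
  then show ?thesis
    using g(1) by (auto simp: all_subgradients_def subgradients_def)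
qed

lemma subgradient_add_normal:
  assumes "c \<in> subgradients g" "n \<in> span (e ` B)" "\<And>y. y \<in> D \<Longrightarrow> dual_apply n y \<le> 0"
  shows "c + n \<in> subgradients g"
proof -
  have "ereal (dual_apply (c + n) y) \<le> h g y" if "y \<in> D" for y
  proof -
    have "ereal (dual_apply (c + n) y) \<le> ereal (dual_apply c y)"
      using assms(3)[OF that] by simp
    also have "\<dots> \<le> h g y" using assms(1) that by (simp add: subgradients_def)
    finally show ?thesis .
  qed
  then show ?thesis
    using assms(1,2) by (auto simp: subgradients_def intro: span_add)
qed

text \<open>Otherwise perturb \<open>v\<close> along an internal \<open>w\<close>. If the ray of the
  perturbed vector meets \<open>D\<close>, a further perturbation is a positive multiple of an
  internal point, where some subgradient is nonnegative. If not, a normal that is positive at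
  \<open>v\<close> can be added to a subgradient until its value at \<open>v\<close> is
  nonnegative.\<close>

lemma no_strict_separation:
  assumes v: "v \<in> span B" and \<delta>: "0 < \<delta>"
  shows "\<exists>c\<in>all_subgradients. - \<delta> < dual_apply c v"
proof (rule ccontr)
  assume "\<not> ?thesis"
  then have sep: "\<And>c. c \<in> all_subgradients \<Longrightarrow> dual_apply c v \<le> - \<delta>"
    by force
  obtain w where w: "internal w" using ex_internal ..
  \<comment> \<open>Ensures \<open>\<epsilon> * M w < \<delta>\<close>; the summand 1 avoids
    division by 0.\<close>
  define \<epsilon> where "\<epsilon> = \<delta> / (\<bar>M w\<bar> + 1)"
  have \<epsilon>: "0 < \<epsilon>" using \<delta> by (simp add: \<epsilon>_def)
  have "\<epsilon> * (\<bar>M w\<bar> + 1) = \<delta>" by (simp add: \<epsilon>_def)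
  moreover have "\<epsilon> * M w \<le> \<epsilon> * \<bar>M w\<bar>"
    using \<epsilon> by (intro mult_left_mono) auto
  ultimately have \<epsilon>M: "\<epsilon> * M w < \<delta>"
    using \<epsilon> unfolding distrib_left by linarith
  have wD: "w \<in> D" using w by (rule internal_in)
  then have w_span: "w \<in> span B" using D_span by blast
  define v' where "v' = v + (\<epsilon> / 2) *\<^sub>R w"
  have v': "v' \<in> span B" unfolding v'_def using v w_span by (intro span_add span_scale)
  show False
  proof (cases "\<exists>\<alpha>>0. \<alpha> *\<^sub>R v' \<in> D")
    case True
    then obtain \<alpha> where \<alpha>: "0 < \<alpha>" "\<alpha> *\<^sub>R v' \<in> D" by blast
    define \<beta> where "\<beta> = \<alpha> * (\<epsilon> / 2)"
    \<comment> \<open>Mixing in \<open>w\<close> with this weight adds a second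
      \<open>\<epsilon> / 2\<close> times \<open>w\<close>, so the mixture is a positive multiple of
      \<open>v + \<epsilon> *\<^sub>R w\<close>.\<close>
    define \<mu> where "\<mu> = \<beta> / (1 + \<beta>)"
    have \<beta>: "0 < \<beta>" using \<alpha> \<epsilon> by (simp add: \<beta>_def)
    then have \<mu>: "0 < \<mu>" "\<mu> < 1" and "(1 + \<beta>) * \<mu> = \<beta>" by (simp_all add: \<mu>_def)
    then have "\<mu> = (1 - \<mu>) * \<beta>" by (simp add: algebra_simps)
    then have \<mu>eq: "\<mu> = (1 - \<mu>) * \<alpha> * (\<epsilon> / 2)" by (simp add: \<beta>_def mult.assoc)
    have "internal ((1 - \<mu>) *\<^sub>R \<alpha> *\<^sub>R v' + \<mu> *\<^sub>R w)"
      using \<alpha>(2) w \<mu> by (intro internal_mix) auto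
    then obtain c where c: "c \<in> all_subgradients" "0 \<le> dual_apply c ((1 - \<mu>) *\<^sub>R \<alpha> *\<^sub>R v' + \<mu> *\<^sub>R w)"
      using ex_subgradient_nonneg by blast
    have "(1 - \<mu>) *\<^sub>R \<alpha> *\<^sub>R v' + \<mu> *\<^sub>R w = ((1 - \<mu>) * \<alpha>) *\<^sub>R (v' + (\<epsilon> / 2) *\<^sub>R w)"
      by (subst (2) \<mu>eq) (simp add: scaleR_add_right)
    also have "v' + (\<epsilon> / 2) *\<^sub>R w = v + \<epsilon> *\<^sub>R w"
      by (simp add: v'_def add.assoc flip: scaleR_add_left)
    finally have "0 \<le> (1 - \<mu>) * \<alpha> * (dual_apply c v + \<epsilon> * dual_apply c w)"
      using c(2) by (simp add: dual_apply_linear_simps)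
    moreover have "0 < (1 - \<mu>) * \<alpha>" using \<mu> \<alpha> by simp
    ultimately have "0 \<le> dual_apply c v + \<epsilon> * dual_apply c w"
      by (simp add: zero_le_mult_iff)
    moreover have "\<epsilon> * dual_apply c w \<le> \<epsilon> * M w"
      using all_subgradients_bound[OF c(1) wD] \<epsilon> by simp
    ultimately show False using sep[OF c(1)] \<epsilon>M by linarith
  next
    case False
    then obtain n where n: "n \<in> span (e ` B)" "\<And>y. y \<in> D \<Longrightarrow> dual_apply n y \<le> 0"
      "0 \<le> dual_apply n v'" "dual_apply n w \<le> - 1"
      using ex_separating_functional[OF w v'] by blast
    have "(\<epsilon> / 2) * dual_apply n w \<le> (\<epsilon> / 2) * (- 1)"
      using n(4) \<epsilon> by (intro mult_left_mono) auto
    then have nv: "0 < dual_apply n v"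
      using n(3) \<epsilon> by (simp add: v'_def dual_apply_linear_simps)
    obtain c where "c \<in> all_subgradients" using ex_subgradient_nonneg[OF w] by blast
    then obtain g where g: "g \<in> G" "c \<in> subgradients g" by (auto simp: all_subgradients_def)
    define \<tau> where "\<tau> = \<bar>dual_apply c v\<bar> / dual_apply n v"
    have \<tau>: "0 \<le> \<tau>" using nv by (simp add: \<tau>_def)
    have "c + \<tau> *\<^sub>R n \<in> subgradients g"
      using n(1,2) \<tau> by (intro subgradient_add_normal g(2)) (auto intro: span_scale mult_nonneg_nonpos)
    then have "dual_apply (c + \<tau> *\<^sub>R n) v \<le> - \<delta>"
      using g(1) by (intro sep) (auto simp: all_subgradients_def)
    moreover have "\<tau> * dual_apply n v = \<bar>dual_apply c v\<bar>" using nv by (simp add: \<tau>_def)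
    ultimately show False using \<delta> by simp
  qed
qed

text \<open>Otherwise the hull keeps distance \<open>\<delta>\<close> from 0 in a coordinate
  seminorm. Hahn-Banach on the dual space then gives a functional at most \<open>- \<delta>\<close>
  on all subgradients; on the span of the \<open>e b\<close> it is evaluation at a vector of
  \<open>span B\<close>, against \<open>no_strict_separation\<close>.\<close>

lemma near_zero_in_hull:
  assumes \<delta>: "0 < \<delta>"
  shows "\<exists>c\<in>convex hull all_subgradients. (\<Sum>b\<in>B. \<bar>dual_apply c b\<bar>) < \<delta>"
proof (rule ccontr)
  define N where "N c = (\<Sum>b\<in>B. \<bar>dual_apply c b\<bar>)" for c :: "'a dual"
  let ?K = "convex hull all_subgradients"
  assume "\<not> ?thesis"
  then have far: "\<And>c. c \<in> ?K \<Longrightarrow> \<delta> \<le> N c"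
    by (force simp: N_def)
  have N_add: "N (c + c') \<le> N c + N c'" for c c'
    unfolding N_def by (auto simp flip: sum.distrib intro!: sum_mono)
  have N_scale: "N (t *\<^sub>R c) = \<bar>t\<bar> * N c" for t c
    unfolding N_def by (simp add: abs_mult sum_distrib_left)
  \<comment> \<open>The constraints bound \<open>\<phi>\<close> by \<open>N\<close> everywhere and
    by \<open>- \<delta>\<close> on the hull.\<close>
  define S where "S = {(d, r). \<exists>s c. 0 \<le> s \<and> c \<in> ?K \<and> N (d - s *\<^sub>R c) - s * \<delta> \<le> r}"
  have SI: "(d, r) \<in> S" if "N (d - s *\<^sub>R c) - s * \<delta> \<le> r" "0 \<le> s" "c \<in> ?K" for d r s c
    using that unfolding S_def by blast
  obtain w where w: "internal w" using ex_internal ..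
  obtain c0 where "c0 \<in> all_subgradients" using ex_subgradient_nonneg[OF w] by blast
  then have c0: "c0 \<in> ?K" by (rule hull_inc)
  obtain \<phi> where \<phi>: "linear \<phi>" and le: "\<And>d r. (d, r) \<in> S \<Longrightarrow> \<phi> d \<le> r"
  proof (rule linear_minorant_of_cone[of S])
    fix x x' assume "x \<in> S" "x' \<in> S"
    then obtain d r s c d' r' s' c' where x: "x = (d, r)" "0 \<le> s" "c \<in> ?K" "N (d - s *\<^sub>R c) - s * \<delta> \<le> r"
      and x': "x' = (d', r')" "0 \<le> s'" "c' \<in> ?K" "N (d' - s' *\<^sub>R c') - s' * \<delta> \<le> r'"
      unfolding S_def by blast
    obtain c'' where c'': "c'' \<in> ?K" "(s + s') *\<^sub>R c'' = s *\<^sub>R c + s' *\<^sub>R c'"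
      using convex_scaled_add[OF convex_convex_hull x(3) x'(3) x(2) x'(2)] .
    have "d + d' - (s + s') *\<^sub>R c'' = (d - s *\<^sub>R c) + (d' - s' *\<^sub>R c')"
      unfolding c''(2) by simp
    then have "N (d + d' - (s + s') *\<^sub>R c'') \<le> N (d - s *\<^sub>R c) + N (d' - s' *\<^sub>R c')"
      using N_add[of "d - s *\<^sub>R c" "d' - s' *\<^sub>R c'"] by metis
    then have "N (d + d' - (s + s') *\<^sub>R c'') - (s + s') * \<delta> \<le> r + r'"
      using x(4) x'(4) unfolding distrib_right by linarith
    then show "x + x' \<in> S"
      unfolding x(1) x'(1) add_Pair using x(2) x'(2) c''(1) by (intro SI[of _ "s + s'" c'']) auto
  next
    fix t :: real and x assume t: "0 \<le> t" and "x \<in> S"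
    then obtain d r s c where x: "x = (d, r)" "0 \<le> s" "c \<in> ?K" "N (d - s *\<^sub>R c) - s * \<delta> \<le> r"
      unfolding S_def by blast
    have "t *\<^sub>R d - (t * s) *\<^sub>R c = t *\<^sub>R (d - s *\<^sub>R c)"
      by (simp add: scaleR_diff_right)
    then have "N (t *\<^sub>R d - (t * s) *\<^sub>R c) - (t * s) * \<delta> = t * (N (d - s *\<^sub>R c) - s * \<delta>)"
      using t by (simp add: N_scale right_diff_distrib)
    also have "\<dots> \<le> t * r" using x(4) t by (rule mult_left_mono)
    finally show "t *\<^sub>R x \<in> S"
      unfolding x(1) scaleR_Pair using t x(2,3) by (intro SI[of _ "t * s" c]) auto
  next
    fix d
    have "(d, N d) \<in> S" using c0 by (intro SI[of _ 0]) auto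
    then show "\<exists>r. (d, r) \<in> S" ..
  next
    fix r assume "(0, r) \<in> S"
    then obtain s c where s: "0 \<le> s" "c \<in> ?K" "N (0 - s *\<^sub>R c) - s * \<delta> \<le> r"
      unfolding S_def by blast
    have "N (0 - s *\<^sub>R c) = s * N c"
      using N_scale[of "- s" c] s(1) by simp
    moreover have "s * \<delta> \<le> s * N c" using far[OF s(2)] s(1) by (rule mult_left_mono)
    ultimately show "0 \<le> r" using s(3) by simp
  qed blast
  \<comment> \<open>The vector representing \<open>\<phi>\<close> on the span of the
    \<open>e b\<close>, where \<open>\<phi> c = dual_apply c v\<close>.\<close>
  define v where "v = (\<Sum>b\<in>B. \<phi> (e b) *\<^sub>R b)"
  have v: "v \<in> span B" unfolding v_def by (intro span_sum span_scale span_base)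
  have "dual_apply c v \<le> - \<delta>" if c: "c \<in> all_subgradients" for c
  proof -
    have c_span: "c \<in> span (e ` B)"
      using c by (auto simp: all_subgradients_def subgradients_def)
    have "dual_apply c v = \<phi> (extend (dual_apply c))"
      unfolding v_def extend_def linear_sum[OF \<phi>] linear_scale[OF \<phi>] dual_apply_linear_simps
      by (simp add: mult.commute)
    also have "\<dots> = \<phi> c" using extend_dual_apply[OF c_span] by simp
    also have "N (c - 1 *\<^sub>R c) - 1 * \<delta> \<le> - \<delta>" by (simp add: N_def)
    then have "(c, - \<delta>) \<in> S" using hull_inc[OF c] by (intro SI[of _ 1 c]) auto
    then have "\<phi> c \<le> - \<delta>" by (rule le)
    finally show ?thesis .
  qed
  then show False using no_strict_separation[OF v \<delta>] by force
qed

text \<open>The vectors \<open>\<lambda>\<^sub>i c\<^sub>i\<close> of convex combinations tending to \<open>0\<close> are bounded even where the subgradients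
  \<open>c\<^sub>i\<close> are not: \<open>M\<close> bounds them above on \<open>B \<subseteq> D\<close>, hence below since their sum is bounded. Where
  \<open>\<lambda>\<^sub>i \<longlonglongrightarrow> 0\<close> their limit is normal to \<open>D\<close> at \<open>0\<close> and can be added to any other subgradient.\<close>

lemma zero_in_hull: "0 \<in> convex hull all_subgradients"
proof -
  define n where "n = card (e ` B)"
  \<comment> \<open>\<open>n\<close> bounds the dimension of the span of the \<open>e b\<close>, so
    the same \<open>n + 1\<close> indices serve for every \<open>k\<close>.\<close>
  define Q where "Q k g c l \<longleftrightarrow> (\<forall>i\<le>n. g i \<in> G \<and> c i \<in> subgradients (g i) \<and> (0::real) \<le> l i) \<and>
    (\<Sum>i\<le>n. l i) = 1 \<and> (\<forall>b\<in>B. \<bar>\<Sum>i\<le>n. l i * dual_apply (c i) b\<bar> < inverse (real (Suc k)))" for k g c l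
  have "\<exists>g c l. Q k g c l" for k
  proof -
    obtain x where x: "x \<in> convex hull all_subgradients" "(\<Sum>b\<in>B. \<bar>dual_apply x b\<bar>) < inverse (real (Suc k))"
      using near_zero_in_hull[of "inverse (real (Suc k))"] by auto
    have "all_subgradients \<subseteq> span (e ` B)"
      by (auto simp: all_subgradients_def subgradients_def)
    then obtain c l where cl: "\<forall>i\<le>n. c i \<in> all_subgradients \<and> (0::real) \<le> l i" "(\<Sum>i\<le>n. l i) = 1"
      "(\<Sum>i\<le>n. l i *\<^sub>R c i) = x"
      using caratheodory_span_indexed[OF finite_imageI[OF finite_B] _ x(1)] unfolding n_def by blast
    have "\<forall>i. \<exists>g. i \<le> n \<longrightarrow> g \<in> G \<and> c i \<in> subgradients g"
      using cl(1) by (auto simp: all_subgradients_def)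
    then obtain g where g: "\<And>i. i \<le> n \<Longrightarrow> g i \<in> G \<and> c i \<in> subgradients (g i)"
      by metis
    have "\<bar>\<Sum>i\<le>n. l i * dual_apply (c i) b\<bar> < inverse (real (Suc k))" if "b \<in> B" for b
    proof -
      have "\<bar>dual_apply x b\<bar> \<le> (\<Sum>b\<in>B. \<bar>dual_apply x b\<bar>)"
        using that finite_B by (intro member_le_sum) auto
      then show ?thesis using x(2) by (simp flip: cl(3))
    qed
    then have "Q k g c l" using g cl(1,2) unfolding Q_def by simp
    then show ?thesis by blast
  qed
  then obtain g c l where "\<And>k. Q k (g k) (c k) (l k)" by metis
  then have
    g: "\<And>k i. i \<le> n \<Longrightarrow> g k i \<in> G" and c: "\<And>k i. i \<le> n \<Longrightarrow> c k i \<in> subgradients (g k i)" and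
    l: "\<And>k i. i \<le> n \<Longrightarrow> (0::real) \<le> l k i" and l1: "\<And>k. (\<Sum>i\<le>n. l k i) = 1" and
    small: "\<And>k b. b \<in> B \<Longrightarrow> \<bar>\<Sum>i\<le>n. l k i * dual_apply (c k i) b\<bar> < inverse (real (Suc k))"
    unfolding Q_def by blast+
  have c_all: "c k i \<in> all_subgradients" if "i \<le> n" for k i
    using g[OF that] c[OF that] by (auto simp: all_subgradients_def)
  have l_le: "l k i \<le> 1" if "i \<le> n" for k i
    using member_le_sum[of i "{..n}" "l k"] that l l1[of k] by auto
  define u where "u = (\<lambda>(i, b) k. l k i * dual_apply (c k i) b)"
  have u_le: "l k i * dual_apply (c k i) y \<le> l k i * M y" if "i \<le> n" "y \<in> D" for k i y
    using all_subgradients_bound[OF c_all that(2)] that l by (intro mult_left_mono) auto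
  have "\<bar>u (i, b) k\<bar> \<le> 1 + \<bar>M b\<bar> + real n * \<bar>M b\<bar>" if "i \<le> n" "b \<in> B" for i b k
  proof -
    have up: "u (j, b) k \<le> \<bar>M b\<bar>" if "j \<le> n" for j
    proof -
      have "u (j, b) k \<le> l k j * M b" using u_le[OF that, of b k] \<open>b \<in> B\<close> B_D by (auto simp: u_def)
      also have "\<dots> \<le> l k j * \<bar>M b\<bar>" using l[OF that] by (intro mult_left_mono) auto
      also have "\<dots> \<le> 1 * \<bar>M b\<bar>" using l_le[OF that] by (intro mult_right_mono) auto
      finally show ?thesis by simp
    qed
    have "(\<Sum>j\<le>n. u (j, b) k) = u (i, b) k + (\<Sum>j\<in>{..n} - {i}. u (j, b) k)"
      using that(1) by (intro sum.remove) auto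
    moreover have "(\<Sum>j\<in>{..n} - {i}. u (j, b) k) \<le> (\<Sum>j\<in>{..n} - {i}. \<bar>M b\<bar>)"
      by (intro sum_mono up) auto
    moreover have "\<dots> = real n * \<bar>M b\<bar>" using that(1) by simp
    moreover have "\<bar>\<Sum>j\<le>n. u (j, b) k\<bar> \<le> 1"
      using small[OF that(2), of k] inverse_le_1_iff[of "real (Suc k)"] unfolding u_def by simp
    ultimately have "- 1 - real n * \<bar>M b\<bar> \<le> u (i, b) k" by linarith
    moreover have "0 \<le> real n * \<bar>M b\<bar>" by simp
    ultimately show ?thesis using up[OF that(1)] by linarith
  qed
  then have bnd_u: "bounded (range (u j))" if "j \<in> {..n} \<times> B" for j
    using that by (cases j) (auto simp: bounded_iff)
  have bnd_l: "bounded (range (\<lambda>k. l k i))" if "i \<in> {..n}" for i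
    using that l l_le by (auto simp: bounded_iff intro!: exI[of _ 1])
  obtain r1 \<rho> where r1: "strict_mono r1" "\<And>i. i \<in> {..n} \<Longrightarrow> (\<lambda>k. l (r1 k) i) \<longlonglongrightarrow> \<rho> i"
    using common_convergent_subsequence[of "{..n}" "\<lambda>i k. l k i"] bnd_l by blast
  have "bounded (range (\<lambda>k. u j (r1 k)))" if "j \<in> {..n} \<times> B" for j
    using bnd_u[OF that] by (rule bounded_subset) auto
  then obtain r2 \<upsilon> where r2: "strict_mono r2" "\<And>j. j \<in> {..n} \<times> B \<Longrightarrow> (\<lambda>k. u j (r1 (r2 k))) \<longlonglongrightarrow> \<upsilon> j"
    using common_convergent_subsequence[of "{..n} \<times> B" "\<lambda>j k. u j (r1 k)"] finite_B by blast
  define r where "r k = r1 (r2 k)" for k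
  have r: "strict_mono r" using strict_mono_o[OF r1(1) r2(1)] by (simp add: r_def[abs_def] o_def)
  have lim_l: "(\<lambda>k. l (r k) i) \<longlonglongrightarrow> \<rho> i" if "i \<le> n" for i
    using LIMSEQ_subseq_LIMSEQ[OF r1(2) r2(1)] that by (simp add: r_def o_def)
  have lim_u: "(\<lambda>k. l (r k) i * dual_apply (c (r k) i) b) \<longlonglongrightarrow> \<upsilon> (i, b)" if "i \<le> n" "b \<in> B" for i b
    using r2(2)[of "(i, b)"] that by (simp add: r_def u_def)
  \<comment> \<open>The limit of the weighted subgradients. \<open>extend\<close> reads only the
    coordinate limits on \<open>B\<close>; \<open>lim_U\<close> recovers convergence on all of
    \<open>D\<close>.\<close>
  define U where "U i = extend (\<lambda>b. \<upsilon> (i, b))" for i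
  have U_span: "U i \<in> span (e ` B)" for i unfolding U_def by (rule extend_in_span)
  have lim_U: "(\<lambda>k. l (r k) i * dual_apply (c (r k) i) y) \<longlonglongrightarrow> dual_apply (U i) y" if "i \<le> n" "y \<in> D" for i y
  proof -
    have y: "y \<in> span B" using that(2) D_span by blast
    have expand: "dual_apply x y = (\<Sum>b\<in>B. dual_apply x b * dual_apply (e b) y)" for x
    proof -
      have "dual_apply x y = dual_apply (extend (dual_apply x)) y"
        using dual_apply_extend[OF linear_dual_apply y] by simp
      then show ?thesis by (simp add: extend_def)
    qed
    have "l (r k) i * dual_apply (c (r k) i) y =
        (\<Sum>b\<in>B. (l (r k) i * dual_apply (c (r k) i) b) * dual_apply (e b) y)" for k
      unfolding expand[of "c (r k) i"] by (simp add: sum_distrib_left mult.assoc)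
    moreover have "(\<lambda>k. \<Sum>b\<in>B. (l (r k) i * dual_apply (c (r k) i) b) * dual_apply (e b) y)
        \<longlonglongrightarrow> (\<Sum>b\<in>B. \<upsilon> (i, b) * dual_apply (e b) y)"
      by (intro tendsto_intros lim_u that(1))
    ultimately show ?thesis by (simp add: U_def extend_def)
  qed
  have \<rho>0: "0 \<le> \<rho> i" if "i \<le> n" for i
    using lim_l[OF that] by (rule LIMSEQ_le_const) (use l that in auto)
  have \<rho>1: "(\<Sum>i\<le>n. \<rho> i) = 1"
  proof -
    have "(\<lambda>k. \<Sum>i\<le>n. l (r k) i) \<longlonglongrightarrow> (\<Sum>i\<le>n. \<rho> i)"
      by (intro tendsto_sum lim_l) auto
    then show ?thesis by (simp add: l1 LIMSEQ_const_iff)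
  qed
  have U0: "(\<Sum>i\<le>n. U i) = 0"
  proof -
    have "(\<Sum>i\<le>n. \<upsilon> (i, b)) = 0" if b: "b \<in> B" for b
    proof -
      have "(\<lambda>k. \<Sum>i\<le>n. l (r k) i * dual_apply (c (r k) i) b) \<longlonglongrightarrow> (\<Sum>i\<le>n. \<upsilon> (i, b))"
        by (intro tendsto_sum lim_u b) auto
      moreover have "(\<lambda>k. \<Sum>i\<le>n. l (r k) i * dual_apply (c (r k) i) b) \<longlonglongrightarrow> 0"
      proof (rule Lim_null_comparison)
        show "\<forall>\<^sub>F k in sequentially. norm (\<Sum>i\<le>n. l (r k) i * dual_apply (c (r k) i) b) \<le> inverse (real (Suc (r k)))"
          unfolding real_norm_def using small[OF b] by (intro always_eventually allI less_imp_le)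
        show "(\<lambda>k. inverse (real (Suc (r k)))) \<longlonglongrightarrow> 0"
          using LIMSEQ_subseq_LIMSEQ[OF LIMSEQ_inverse_real_of_nat r] by (simp add: o_def)
      qed
      ultimately show ?thesis by (rule LIMSEQ_unique)
    qed
    moreover have "(\<Sum>i\<le>n. U i) = (\<Sum>b\<in>B. (\<Sum>i\<le>n. \<upsilon> (i, b)) *\<^sub>R e b)"
      unfolding U_def extend_def by (subst sum.swap) (simp add: scaleR_sum_left)
    ultimately show ?thesis by simp
  qed
  define P where "P = {i. i \<le> n \<and> 0 < \<rho> i}"
  define Z where "Z = {i. i \<le> n \<and> \<rho> i = 0}"
  have PZ: "P \<union> Z = {..n}" "P \<inter> Z = {}" "finite P" "finite Z"
    using \<rho>0 by (force simp: P_def Z_def)+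
  have sum_PZ: "sum f {..n} = sum f P + sum f Z" for f :: "nat \<Rightarrow> 'b::comm_monoid_add"
    using PZ by (metis sum.union_disjoint)
  have \<rho>P: "sum \<rho> P = 1"
    using \<rho>1 sum_PZ[of \<rho>] by (simp add: Z_def)
  then obtain i0 where i0: "i0 \<in> P" by force
  define Nrm where "Nrm = (\<Sum>i\<in>Z. U i)"
  have Nrm_span: "Nrm \<in> span (e ` B)" unfolding Nrm_def by (intro span_sum U_span)
  have Nrm_le: "dual_apply Nrm y \<le> 0" if y: "y \<in> D" for y
  proof -
    have "dual_apply (U i) y \<le> 0" if "i \<in> Z" for i
    proof (rule LIMSEQ_le)
      have i: "i \<le> n" "\<rho> i = 0" using that by (auto simp: Z_def)
      show "(\<lambda>k. l (r k) i * dual_apply (c (r k) i) y) \<longlonglongrightarrow> dual_apply (U i) y"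
        using i(1) y by (rule lim_U)
      show "(\<lambda>k. l (r k) i * M y) \<longlonglongrightarrow> 0"
        using tendsto_mult_right[OF lim_l[OF i(1)], of "M y"] i(2) by simp
      show "\<exists>N. \<forall>k\<ge>N. l (r k) i * dual_apply (c (r k) i) y \<le> l (r k) i * M y"
        using u_le[OF i(1) y] by blast
    qed
    then show ?thesis by (simp add: Nrm_def sum_nonpos)
  qed
  have sub: "(1 / \<rho> i) *\<^sub>R U i \<in> all_subgradients" if "i \<in> P" for i
  proof -
    have i: "i \<le> n" "0 < \<rho> i" using that by (auto simp: P_def)
    obtain \<gamma> where \<gamma>: "\<gamma> \<in> G" "\<And>y q. y \<in> D \<Longrightarrow>
        (\<forall>\<^sub>F k in sequentially. ereal q < h (g (r k) i) y) \<Longrightarrow> ereal q \<le> h \<gamma> y"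
      using cluster[of "\<lambda>k. g (r k) i"] g i(1) by blast
    \<comment> \<open>For a positive limit weight, division recovers the limit of the subgradients
      themselves. \<open>cluster\<close> transfers strict eventual bounds by reals, hence the test
      with every smaller \<open>q\<close>.\<close>
    have "ereal (dual_apply ((1 / \<rho> i) *\<^sub>R U i) y) \<le> h \<gamma> y" if y: "y \<in> D" for y
    proof (rule dense_le)
      fix z assume "z < ereal (dual_apply ((1 / \<rho> i) *\<^sub>R U i) y)"
      then show "z \<le> h \<gamma> y"
      proof (cases z)
        case (real q)
        then have q: "q < dual_apply (U i) y / \<rho> i"
          using \<open>z < _\<close> by simp
        have "(\<lambda>k. l (r k) i * dual_apply (c (r k) i) y / l (r k) i) \<longlonglongrightarrow> dual_apply (U i) y / \<rho> i"
          using i by (intro tendsto_divide lim_U lim_l y) auto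
        then have "\<forall>\<^sub>F k in sequentially. q < l (r k) i * dual_apply (c (r k) i) y / l (r k) i"
          using q by (rule order_tendstoD)
        moreover have "\<forall>\<^sub>F k in sequentially. 0 < l (r k) i"
          using lim_l[OF i(1)] i(2) by (rule order_tendstoD)
        ultimately have "\<forall>\<^sub>F k in sequentially. ereal q < h (g (r k) i) y"
        proof eventually_elim
          case (elim k)
          then have "ereal q < ereal (dual_apply (c (r k) i) y)" by simp
          also have "\<dots> \<le> h (g (r k) i) y" using c[OF i(1)] y by (simp add: subgradients_def)
          finally show ?case .
        qed
        then show ?thesis using \<gamma>(2)[OF y] real by simp
      qed auto
    qed
    then have "(1 / \<rho> i) *\<^sub>R U i \<in> subgradients \<gamma>"
      unfolding subgradients_def using U_span by (auto intro: span_scale)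
    then show ?thesis using \<gamma>(1) by (auto simp: all_subgradients_def)
  qed
  \<comment> \<open>The normal part goes to the single index \<open>i0\<close>, scaled so that its
    weight in the combination is 1 and the total is the sum of all \<open>U i\<close>.\<close>
  define x where "x i = (1 / \<rho> i) *\<^sub>R U i + (if i = i0 then (1 / \<rho> i) *\<^sub>R Nrm else 0)" for i
  have x: "x i \<in> all_subgradients" if "i \<in> P" for i
  proof (cases "i = i0")
    case True
    obtain \<gamma> where \<gamma>: "\<gamma> \<in> G" "(1 / \<rho> i) *\<^sub>R U i \<in> subgradients \<gamma>"
      using sub[OF \<open>i \<in> P\<close>] by (auto simp: all_subgradients_def)
    have "0 < \<rho> i" using that by (simp add: P_def)
    then have "(1 / \<rho> i) *\<^sub>R U i + (1 / \<rho> i) *\<^sub>R Nrm \<in> subgradients \<gamma>"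
      using \<gamma>(2) Nrm_span Nrm_le
      by (intro subgradient_add_normal) (auto intro: span_scale simp: divide_nonpos_pos)
    then show ?thesis using \<gamma>(1) True by (auto simp: all_subgradients_def x_def)
  qed (use sub[OF that] in \<open>simp add: x_def\<close>)
  have "(\<Sum>i\<in>P. \<rho> i *\<^sub>R x i) = (\<Sum>i\<in>P. U i + (if i = i0 then Nrm else 0))"
    by (intro sum.cong) (auto simp: x_def P_def scaleR_add_right)
  also have "\<dots> = (\<Sum>i\<le>n. U i)"
    using i0 PZ(3) by (simp add: sum.distrib sum_PZ Nrm_def)
  also have "\<dots> = 0" by (rule U0)
  finally have "(\<Sum>i\<in>P. \<rho> i *\<^sub>R x i) = 0" .
  moreover have "(\<Sum>i\<in>P. \<rho> i *\<^sub>R x i) \<in> convex hull all_subgradients"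
    using PZ(3) \<rho>P x by (intro convex_sum convex_convex_hull) (auto simp: P_def hull_inc)
  ultimately show ?thesis by simp
qed

end

section \<open>Limit functions on the compactified index set\<close>

lemma convex_funD:
  assumes "convex_fun h" "h a \<le> ereal p" "h b \<le> ereal q" "0 \<le> u" "0 \<le> v" "u + v = 1"
  shows "h (u *\<^sub>R a + v *\<^sub>R b) \<le> ereal (u * p + v * q)"
  using convexD[OF assms(1)[unfolded convex_fun_def], of "(a, p)" "(b, q)" u v] assms(2-) by auto

lemma convex_funI:
  assumes "\<And>a b p q u v. h a \<le> ereal p \<Longrightarrow> h b \<le> ereal q \<Longrightarrow> 0 \<le> u \<Longrightarrow> 0 \<le> v \<Longrightarrow> u + v = 1 \<Longrightarrow>
    h (u *\<^sub>R a + v *\<^sub>R b) \<le> ereal (u * p + v * q)"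
  shows "convex_fun h"
  unfolding convex_fun_def using assms by (intro convexI) auto

lemma convex_eff_dom:
  assumes "convex_fun h"
  shows "convex (eff_dom h)"
proof (rule convexI)
  fix a b and u v :: real
  assume ab: "a \<in> eff_dom h" "b \<in> eff_dom h" and uv: "0 \<le> u" "0 \<le> v" "u + v = 1"
  obtain p q where "h a \<le> ereal p" "h b \<le> ereal q"
    using ab by (auto simp: eff_dom_def less_PInf_Ex_of_nat dest: less_imp_le)
  then have "h (u *\<^sub>R a + v *\<^sub>R b) \<le> ereal (u * p + v * q)"
    using assms uv by (intro convex_funD)
  then show "u *\<^sub>R a + v *\<^sub>R b \<in> eff_dom h"
    by (auto simp: eff_dom_def intro: le_less_trans)
qed

lemma le_sup_fun: "t \<in> topspace T \<Longrightarrow> f t z \<le> sup_fun T f z"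
  unfolding sup_fun_def by (rule SUP_upper)

lemma convex_fun_sup_fun:
  assumes "\<And>t. t \<in> topspace T \<Longrightarrow> convex_fun (f t)"
  shows "convex_fun (sup_fun T f)"
proof (rule convex_funI)
  fix a b p q and u v :: real
  assume h: "sup_fun T f a \<le> ereal p" "sup_fun T f b \<le> ereal q" "0 \<le> u" "0 \<le> v" "u + v = 1"
  show "sup_fun T f (u *\<^sub>R a + v *\<^sub>R b) \<le> ereal (u * p + v * q)"
    unfolding sup_fun_def
  proof (rule SUP_least)
    fix t assume t: "t \<in> topspace T"
    show "f t (u *\<^sub>R a + v *\<^sub>R b) \<le> ereal (u * p + v * q)"
      using assms[OF t] order_trans[OF le_sup_fun[OF t] h(1)] order_trans[OF le_sup_fun[OF t] h(2)] h(3-5)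
      by (rule convex_funD)
  qed
qed

section \<open>Limit functions as upper limits along one filter\<close>

lemma lim_fun_le_sup_fun: "lim_fun T f \<gamma> z \<le> sup_fun T f z"
  unfolding lim_fun_def
  by (rule SUP_least, rule Limsup_bounded) (auto simp: le_principal le_sup_fun elim!: eventually_mono)

lemma limitin_iff_le_filtercomap:
  "limitin X g l F \<longleftrightarrow> l \<in> topspace X \<and> F \<le> filtercomap g (nhdsin X l)"
proof (cases "l \<in> topspace X")
  case True
  have "filterlim g (nhdsin X l) F" if lim: "limitin X g l F"
    unfolding filterlim_iff eventually_nhdsin
  proof (intro allI impI)
    fix P assume "l \<notin> topspace X \<or> (\<exists>S. openin X S \<and> l \<in> S \<and> (\<forall>x\<in>S. P x))"
    then obtain S where "openin X S" "l \<in> S" "\<forall>x\<in>S. P x" using True by blast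
    then show "\<forall>\<^sub>F x in F. P (g x)"
      using limitinD[OF lim, of S] by (auto elim: eventually_mono)
  qed
  moreover have "limitin X g l F" if lim: "filterlim g (nhdsin X l) F"
    unfolding limitin_def
  proof (intro conjI allI impI True)
    fix U assume "openin X U \<and> l \<in> U"
    then have "\<forall>\<^sub>F y in nhdsin X l. y \<in> U"
      unfolding eventually_nhdsin by blast
    then show "\<forall>\<^sub>F x in F. g x \<in> U" by (rule lim[unfolded filterlim_iff, rule_format])
  qed
  ultimately show ?thesis using True unfolding filterlim_iff_le_filtercomap by blast
qed (simp add: limitin_def)

text \<open>\<open>Limsup\<close> is monotone in the filter, so the supremum is attained at the
  largest admissible filter. If that filter is \<open>bot\<close>, both sides are
  \<open>- \<infinity>\<close>.\<close>

lemma lim_fun_eq_Limsup: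
  assumes "\<gamma> \<in> topspace (cube T)"
  shows "lim_fun T f \<gamma> z =
    Limsup (inf (principal (topspace T)) (filtercomap (eval_at T) (nhdsin (cube T) \<gamma>))) (\<lambda>t. f t z)"
    (is "_ = Limsup ?E _")
proof (rule antisym)
  show "lim_fun T f \<gamma> z \<le> Limsup ?E (\<lambda>t. f t z)"
    unfolding lim_fun_def
  proof (rule SUP_least)
    fix F assume "F \<in> {F. F \<noteq> bot \<and> F \<le> principal (topspace T) \<and> limitin (cube T) (eval_at T) \<gamma> F}"
    then have "F \<le> ?E" by (simp add: limitin_iff_le_filtercomap)
    then show "Limsup F (\<lambda>t. f t z) \<le> Limsup ?E (\<lambda>t. f t z)"
      unfolding Limsup_def by (intro INF_superset_mono) (auto simp: le_filter_def)
  qed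
  show "Limsup ?E (\<lambda>t. f t z) \<le> lim_fun T f \<gamma> z"
  proof (cases "?E = bot")
    case False
    then show ?thesis
      unfolding lim_fun_def using assms by (intro SUP_upper) (simp add: limitin_iff_le_filtercomap)
  qed simp
qed

text \<open>Trades filters for neighbourhoods in the cube. An open \<open>U\<close> is a
  neighbourhood of each of its points, so this form carries upper semicontinuity in
  \<open>\<gamma>\<close>.\<close>

lemma lim_fun_le_iff:
  assumes "\<gamma> \<in> topspace (cube T)"
  shows "lim_fun T f \<gamma> z \<le> C \<longleftrightarrow>
    (\<forall>y>C. \<exists>U. openin (cube T) U \<and> \<gamma> \<in> U \<and> (\<forall>t\<in>topspace T. eval_at T t \<in> U \<longrightarrow> f t z < y))"
proof -
  let ?E = "filtercomap (eval_at T) (nhdsin (cube T) \<gamma>)"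
  have "eventually P (inf (principal (topspace T)) ?E) \<longleftrightarrow>
      (\<exists>U. openin (cube T) U \<and> \<gamma> \<in> U \<and> (\<forall>t\<in>topspace T. eval_at T t \<in> U \<longrightarrow> P t))" (is "?L \<longleftrightarrow> ?R") for P
  proof
    assume ?L
    then obtain Q where "eventually Q (nhdsin (cube T) \<gamma>)" "\<And>t. Q (eval_at T t) \<Longrightarrow> t \<in> topspace T \<Longrightarrow> P t"
      unfolding inf_commute[of "principal _"] eventually_inf_principal eventually_filtercomap by blast
    then show ?R
      using assms unfolding eventually_nhdsin by blast
  next
    assume ?R
    then obtain U where U: "openin (cube T) U" "\<gamma> \<in> U" "\<And>t. t \<in> topspace T \<Longrightarrow> eval_at T t \<in> U \<Longrightarrow> P t"
      by blast
    then have "\<forall>\<^sub>F y in nhdsin (cube T) \<gamma>. y \<in> U"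
      unfolding eventually_nhdsin by blast
    then show ?L
      unfolding inf_commute[of "principal _"] eventually_inf_principal eventually_filtercomap
      using U(3) by (intro exI[of _ "\<lambda>y. y \<in> U"]) simp
  qed
  then show ?thesis
    unfolding lim_fun_eq_Limsup[OF assms] Limsup_le_iff by simp
qed

section \<open>Compactness of the extended index set and upper semicontinuity\<close>

lemma T_hat_subset: "T_hat T \<subseteq> topspace (cube T)"
  unfolding T_hat_def by (rule closure_of_subset_topspace)

lemma eval_at_in_T_hat:
  assumes "t \<in> topspace T"
  shows "eval_at T t \<in> T_hat T"
proof -
  have "eval_at T s \<in> topspace (cube T)" if "s \<in> topspace T" for s
    using that by (auto simp: cube_def eval_at_def unit_funs_def continuous_map_def)
  then have "eval_at T ` topspace T \<subseteq> T_hat T"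
    unfolding T_hat_def by (intro closure_of_subset) auto
  then show ?thesis using assms by blast
qed

lemma compactin_T_hat: "compactin (cube T) (T_hat T)"
proof -
  have "compact_space (cube T)"
    unfolding cube_def by (simp add: compact_space_product_topology compact_space_subtopology)
  then show ?thesis
    unfolding T_hat_def by (intro closedin_compact_space) auto
qed

text \<open>Uses the constant net at \<open>t\<close>, represented by a principal filter.\<close>

lemma le_lim_fun_eval_at:
  assumes "t \<in> topspace T"
  shows "f t z \<le> lim_fun T f (eval_at T t) z"
proof -
  have "eval_at T t \<in> topspace (cube T)"
    using eval_at_in_T_hat[OF assms] T_hat_subset by blast
  then have "limitin (cube T) (eval_at T) (eval_at T t) (principal {t})"
    by (simp add: limitin_def eventually_principal)
  then have "Limsup (principal {t}) (\<lambda>t. f t z) \<le> lim_fun T f (eval_at T t) z"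
    unfolding lim_fun_def using assms by (intro SUP_upper) (simp add: principal_eq_bot_iff)
  moreover have "f t z \<le> Limsup (principal {t}) (\<lambda>t. f t z)"
    by (rule Limsup_greatest) (auto simp: eventually_principal intro: SUP_upper)
  ultimately show ?thesis by (rule order_trans[rotated])
qed

text \<open>Relax both bounds by the same \<open>\<epsilon>\<close>; they then hold for every
  \<open>f t\<close> whose evaluation is near \<open>\<gamma>\<close>, and convexity of
  \<open>f t\<close> applies. As \<open>u + v = 1\<close>, the relaxed bounds combine to
  \<open>d\<close>.\<close>

lemma convex_fun_lim_fun:
  assumes "\<And>t. t \<in> topspace T \<Longrightarrow> convex_fun (f t)" "\<gamma> \<in> topspace (cube T)"
  shows "convex_fun (lim_fun T f \<gamma>)"
proof (rule convex_funI)
  fix a b p q and u v :: real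
  assume le: "lim_fun T f \<gamma> a \<le> ereal p" "lim_fun T f \<gamma> b \<le> ereal q" and uv: "0 \<le> u" "0 \<le> v" "u + v = 1"
  show "lim_fun T f \<gamma> (u *\<^sub>R a + v *\<^sub>R b) \<le> ereal (u * p + v * q)"
    unfolding lim_fun_le_iff[OF assms(2)]
  proof (intro allI impI)
    fix y assume "ereal (u * p + v * q) < y"
    then obtain d where d: "u * p + v * q < d" "ereal d < y"
      using ereal_dense2 by (metis less_ereal.simps(1))
    define \<epsilon> where "\<epsilon> = d - (u * p + v * q)"
    have \<epsilon>: "0 < \<epsilon>" using d by (simp add: \<epsilon>_def)
    have "u * (p + \<epsilon>) + v * (q + \<epsilon>) = (u * p + v * q) + (u + v) * \<epsilon>" by (simp add: algebra_simps)
    then have d_eq: "u * (p + \<epsilon>) + v * (q + \<epsilon>) = d" using uv(3) by (simp add: \<epsilon>_def)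
    obtain U where U: "openin (cube T) U" "\<gamma> \<in> U" "\<And>t. t \<in> topspace T \<Longrightarrow> eval_at T t \<in> U \<Longrightarrow> f t a < ereal (p + \<epsilon>)"
      using le(1) \<epsilon> unfolding lim_fun_le_iff[OF assms(2)] by (metis less_add_same_cancel1 less_ereal.simps(1))
    obtain V where V: "openin (cube T) V" "\<gamma> \<in> V" "\<And>t. t \<in> topspace T \<Longrightarrow> eval_at T t \<in> V \<Longrightarrow> f t b < ereal (q + \<epsilon>)"
      using le(2) \<epsilon> unfolding lim_fun_le_iff[OF assms(2)] by (metis less_add_same_cancel1 less_ereal.simps(1))
    have "f t (u *\<^sub>R a + v *\<^sub>R b) < y" if "t \<in> topspace T" "eval_at T t \<in> U \<inter> V" for t
    proof -
      have "f t (u *\<^sub>R a + v *\<^sub>R b) \<le> ereal (u * (p + \<epsilon>) + v * (q + \<epsilon>))"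
        using that by (intro convex_funD[OF assms(1) _ _ uv] less_imp_le U(3) V(3)) auto
      then show ?thesis using d(2) unfolding d_eq by (rule le_less_trans)
    qed
    then show "\<exists>W. openin (cube T) W \<and> \<gamma> \<in> W \<and>
        (\<forall>t\<in>topspace T. eval_at T t \<in> W \<longrightarrow> f t (u *\<^sub>R a + v *\<^sub>R b) < y)"
      using U(1,2) V(1,2) by (intro exI[of _ "U \<inter> V"]) (auto intro: openin_Int)
  qed
qed

text \<open>If every point had a neighbourhood that the sequence eventually avoids, finitely many
  would cover \<open>K\<close>, and the sequence would eventually avoid \<open>K\<close>.\<close>

lemma compactin_sequence_cluster_point:
  fixes s :: "nat \<Rightarrow> 'x"
  assumes "compactin X K" "\<And>k. s k \<in> K"
  shows "\<exists>a\<in>K. \<forall>U. openin X U \<longrightarrow> a \<in> U \<longrightarrow> (\<exists>\<^sub>F k in sequentially. s k \<in> U)"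
proof (rule ccontr)
  assume "\<not> ?thesis"
  then have ex: "\<exists>U. openin X U \<and> a \<in> U \<and> (\<forall>\<^sub>F k in sequentially. s k \<notin> U)" if "a \<in> K" for a
    using that by (auto simp: frequently_def)
  define \<U> where "\<U> = {U. openin X U \<and> (\<forall>\<^sub>F k in sequentially. s k \<notin> U)}"
  have "K \<subseteq> \<Union>\<U>" using ex by (force simp: \<U>_def)
  then obtain \<F> where \<F>: "finite \<F>" "\<F> \<subseteq> \<U>" "K \<subseteq> \<Union>\<F>"
    using compactinD[OF assms(1), of \<U>] by (auto simp: \<U>_def)
  have "\<forall>\<^sub>F k in sequentially. \<forall>U\<in>\<F>. s k \<notin> U"
    using \<F>(1,2) by (intro eventually_ball_finite) (auto simp: \<U>_def)
  from eventually_happens'[OF sequentially_bot this] obtain k where "\<forall>U\<in>\<F>. s k \<notin> U" ..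
  then show False using assms(2)[of k] \<F>(3) by blast
qed

text \<open>If the value at a cluster point \<open>\<gamma>\<close> were below \<open>r\<close>,
  then \<open>f t z < r\<close> for evaluations in a neighbourhood of \<open>\<gamma>\<close>. It
  contains some \<open>gs k\<close> with \<open>k\<close> arbitrarily large, whose value is then at
  most \<open>r\<close>. One \<open>\<gamma>\<close> serves all \<open>z\<close>.\<close>

lemma T_hat_cluster:
  assumes "\<And>k::nat. gs k \<in> T_hat T"
  obtains \<gamma> where "\<gamma> \<in> T_hat T"
    "\<And>z r. (\<forall>\<^sub>F k in sequentially. ereal r < lim_fun T f (gs k) z) \<Longrightarrow> ereal r \<le> lim_fun T f \<gamma> z"
proof -
  have "\<exists>\<gamma>\<in>T_hat T. \<forall>U. openin (cube T) U \<longrightarrow> \<gamma> \<in> U \<longrightarrow> (\<exists>\<^sub>F k in sequentially. gs k \<in> U)"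
    by (rule compactin_sequence_cluster_point[OF compactin_T_hat assms])
  then obtain \<gamma> where \<gamma>: "\<gamma> \<in> T_hat T"
    and freq: "\<And>U. openin (cube T) U \<Longrightarrow> \<gamma> \<in> U \<Longrightarrow> \<exists>\<^sub>F k in sequentially. gs k \<in> U"
    by blast
  have "ereal r \<le> lim_fun T f \<gamma> z" if ev: "\<forall>\<^sub>F k in sequentially. ereal r < lim_fun T f (gs k) z" for z r
  proof (rule ccontr)
    assume "\<not> ereal r \<le> lim_fun T f \<gamma> z"
    then have less: "lim_fun T f \<gamma> z < ereal r" by simp
    have "\<gamma> \<in> topspace (cube T)" using \<gamma> T_hat_subset by blast
    from less obtain U where U: "openin (cube T) U" "\<gamma> \<in> U"
      "\<And>t. t \<in> topspace T \<Longrightarrow> eval_at T t \<in> U \<Longrightarrow> f t z < ereal r"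
      using lim_fun_le_iff[OF \<open>\<gamma> \<in> topspace (cube T)\<close>, of f z "lim_fun T f \<gamma> z"] by auto
    have "\<exists>k. gs k \<in> U \<and> ereal r < lim_fun T f (gs k) z"
      by (rule frequently_ex[OF frequently_eventually_frequently[OF freq[OF U(1,2)] ev]])
    then obtain k where k: "gs k \<in> U" "ereal r < lim_fun T f (gs k) z"
      by blast
    have "gs k \<in> topspace (cube T)" using assms T_hat_subset by blast
    then have "lim_fun T f (gs k) z \<le> ereal r"
      unfolding lim_fun_le_iff[OF \<open>gs k \<in> topspace (cube T)\<close>] using U k(1) by (meson less_trans)
    then show False using k(2) by simp
  qed
  then show ?thesis using that \<gamma> by blast
qed

text \<open>For \<open>f\<^sub>t (x + \<sigma> y) > f x + \<sigma> a - \<sigma>\<^sup>2\<close> with small \<open>\<sigma>\<close>, convexity along the segment from \<open>x\<close> to \<open>x + y\<close>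
  makes the error term negligible at every fixed point of the segment.\<close>

lemma ex_active_on_segment:
  assumes conv: "\<And>t. t \<in> topspace T \<Longrightarrow> convex_fun (f t)"
    and F: "sup_fun T f x = ereal F" and R: "sup_fun T f (x + y) \<le> ereal R"
    and lower: "\<And>s. 0 < s \<Longrightarrow> s \<le> 1 \<Longrightarrow> ereal (F + s * a) \<le> sup_fun T f (x + s *\<^sub>R y)"
  obtains \<gamma> where "\<gamma> \<in> T_hat T"
    "\<And>s. 0 \<le> s \<Longrightarrow> s \<le> 1 \<Longrightarrow> ereal (F + s * a) \<le> lim_fun T f \<gamma> (x + s *\<^sub>R y)"
proof -
  define \<sigma> where "\<sigma> k = inverse (real (Suc k))" for k
  have \<sigma>: "0 < \<sigma> k" "\<sigma> k \<le> 1" for k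
    by (simp_all add: \<sigma>_def inverse_le_1_iff)
  have \<sigma>_lim: "\<sigma> \<longlonglongrightarrow> 0" unfolding \<sigma>_def[abs_def] by (rule LIMSEQ_inverse_real_of_nat)
  have "\<exists>t\<in>topspace T. ereal (F + \<sigma> k * a - (\<sigma> k)\<^sup>2) < f t (x + \<sigma> k *\<^sub>R y)" for k
  proof -
    have "ereal (F + \<sigma> k * a - (\<sigma> k)\<^sup>2) < ereal (F + \<sigma> k * a)" using \<sigma>[of k] by simp
    also have "\<dots> \<le> sup_fun T f (x + \<sigma> k *\<^sub>R y)" using \<sigma> by (rule lower)
    finally show ?thesis unfolding sup_fun_def less_SUP_iff .
  qed
  then obtain t where t: "\<And>k. t k \<in> topspace T"
    and ft: "\<And>k. ereal (F + \<sigma> k * a - (\<sigma> k)\<^sup>2) < f (t k) (x + \<sigma> k *\<^sub>R y)"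
    by metis
  obtain \<gamma> where \<gamma>: "\<gamma> \<in> T_hat T" and cl: "\<And>z r.
      (\<forall>\<^sub>F k in sequentially. ereal r < lim_fun T f (eval_at T (t k)) z) \<Longrightarrow> ereal r \<le> lim_fun T f \<gamma> z"
    using T_hat_cluster[of "\<lambda>k. eval_at T (t k)" T f] eval_at_in_T_hat[OF t] by blast
  have conv_t: "F + \<sigma> k * a - (\<sigma> k)\<^sup>2 < (1 - \<mu>) * p + \<mu> * q"
    if "f (t k) x \<le> ereal p" "f (t k) (x + s *\<^sub>R y) \<le> ereal q" "\<mu> * s = \<sigma> k" "0 \<le> \<mu>" "\<mu> \<le> 1" for k p q s \<mu>
  proof -
    have "f (t k) ((1 - \<mu>) *\<^sub>R x + \<mu> *\<^sub>R (x + s *\<^sub>R y)) \<le> ereal ((1 - \<mu>) * p + \<mu> * q)"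
      using that conv[OF t] by (intro convex_funD) auto
    moreover have "(1 - \<mu>) *\<^sub>R x + \<mu> *\<^sub>R (x + s *\<^sub>R y) = x + \<sigma> k *\<^sub>R y"
      using that(3) by (simp add: scaleR_add_right scaleR_diff_left)
    ultimately have "ereal (F + \<sigma> k * a - (\<sigma> k)\<^sup>2) < ereal ((1 - \<mu>) * p + \<mu> * q)"
      using ft[of k] by (metis less_le_trans)
    then show ?thesis by simp
  qed
  have ftx: "f (t k) x \<le> ereal F" for k using le_sup_fun[OF t[of k], of f x] F by simp
  have "ereal (F + s * a) \<le> lim_fun T f \<gamma> (x + s *\<^sub>R y)" if s: "0 \<le> s" "s \<le> 1" for s
  proof (rule dense_le)
    fix z assume z: "z < ereal (F + s * a)"
    show "z \<le> lim_fun T f \<gamma> (x + s *\<^sub>R y)"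
    proof (cases z)
      case (real r)
      then have r: "r < F + s * a" using z by simp
      have "\<forall>\<^sub>F k in sequentially. ereal r < f (t k) (x + s *\<^sub>R y)"
      proof (cases "s = 0")
        case True
        \<comment> \<open>At \<open>x\<close> itself the second reference point is
          \<open>x + y\<close>: its bound \<open>R\<close> enters with weight
          \<open>\<sigma> k\<close> and disappears in the limit.\<close>
        have "(\<lambda>k. (F + \<sigma> k * a - (\<sigma> k)\<^sup>2) - ((1 - \<sigma> k) * r + \<sigma> k * R))
            \<longlonglongrightarrow> (F + 0 * a - 0\<^sup>2) - ((1 - 0) * r + 0 * R)"
          by (intro tendsto_intros \<sigma>_lim)
        moreover have "0 < (F + 0 * a - 0\<^sup>2) - ((1 - 0) * r + 0 * R)" using r True by simp
        ultimately have "\<forall>\<^sub>F k in sequentially. 0 < (F + \<sigma> k * a - (\<sigma> k)\<^sup>2) - ((1 - \<sigma> k) * r + \<sigma> k * R)"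
          by (rule order_tendstoD)
        then show ?thesis
        proof eventually_elim
          case (elim k)
          have "f (t k) (x + 1 *\<^sub>R y) \<le> ereal R" using le_sup_fun[OF t[of k], of f "x + y"] R by simp
          then have "\<not> f (t k) x \<le> ereal r"
            using conv_t[of k r 1 R "\<sigma> k"] \<sigma>[of k] elim by auto
          then show ?case using True by simp
        qed
      next
        case False
        then have s0: "0 < s" using s by simp
        have "\<forall>\<^sub>F k in sequentially. \<sigma> k < s"
          using \<sigma>_lim s0 by (rule order_tendstoD)
        moreover have "\<forall>\<^sub>F k in sequentially. \<sigma> k < (F + s * a - r) / s"
          using \<sigma>_lim s0 r by (intro order_tendstoD(2)[of _ 0]) auto
        ultimately show ?thesis
        proof eventually_elim
          case (elim k)
          \<comment> \<open>With this weight \<open>x + \<sigma> k *\<^sub>R y\<close> is a mixture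
            of \<open>x\<close> and \<open>x + s *\<^sub>R y\<close>. A bound \<open>r\<close> at
            the latter would force \<open>F + s * a - r < s * \<sigma> k\<close>, false for small
            \<open>\<sigma> k\<close>.\<close>
          define \<mu> where "\<mu> = \<sigma> k / s"
          have \<mu>: "0 < \<mu>" "\<mu> \<le> 1" "\<mu> * s = \<sigma> k" using \<sigma>[of k] elim(1) s0 by (simp_all add: \<mu>_def)
          have "\<not> f (t k) (x + s *\<^sub>R y) \<le> ereal r"
          proof
            assume "f (t k) (x + s *\<^sub>R y) \<le> ereal r"
            then have "F + \<sigma> k * a - (\<sigma> k)\<^sup>2 < (1 - \<mu>) * F + \<mu> * r"
              using ftx \<mu> by (intro conv_t[of k F s]) auto
            moreover have "\<mu> * (r - F - s * a + s * \<sigma> k) = \<mu> * r - \<mu> * F - (\<mu> * s) * a + (\<mu> * s) * \<sigma> k"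
              by (simp add: algebra_simps)
            ultimately have "0 < \<mu> * (r - F - s * a + s * \<sigma> k)"
              unfolding \<mu>(3) by (simp add: algebra_simps power2_eq_square)
            then have "0 < r - F - s * a + s * \<sigma> k"
              using \<mu>(1) by (simp add: zero_less_mult_iff)
            moreover have "s * \<sigma> k < F + s * a - r"
              using elim(2) s0 by (simp add: pos_less_divide_eq mult.commute)
            ultimately show False by simp
          qed
          then show ?case by simp
        qed
      qed
      then have "\<forall>\<^sub>F k in sequentially. ereal r < lim_fun T f (eval_at T (t k)) (x + s *\<^sub>R y)"
      proof eventually_elim
        case (elim k)
        then show ?case using le_lim_fun_eval_at[OF t[of k], of f] by (rule less_le_trans)
      qed
      then show ?thesis using cl real by simp
    qed (use z in auto)
  qed
  then show ?thesis using that \<gamma> by blast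
qed

section \<open>The subdifferential of the supremum\<close>

lemma subdiff_le:
  assumes "c \<in> subdiff h x" "h x = ereal F"
  shows "ereal (F + dual_apply c (y - x)) \<le> h y"
  using assms by (auto simp: subdiff_def)

text \<open>After moving \<open>x\<close> to 0 and subtracting \<open>xs\<close>, the active limit
  functions form an \<open>active_convex_family\<close>. Translating \<open>zero_in_hull\<close> by
  \<open>xs\<close> gives the claim.\<close>

lemma subdiff_sup_fun_subset:
  assumes conv: "\<And>t. t \<in> topspace T \<Longrightarrow> convex_fun (f t)"
    and xs: "xs \<in> subdiff (sup_fun T f) x" and L: "L \<in> fin_dim_subspaces x"
  shows "xs \<in> convex hull (\<Union>\<gamma>\<in>T_hat_at T f x.
    subdiff (\<lambda>z. lim_fun T f \<gamma> z + indicator_fun (L \<inter> eff_dom (sup_fun T f)) z) x)"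
    (is "_ \<in> convex hull ?W")
proof -
  have "\<bar>sup_fun T f x\<bar> \<noteq> \<infinity>"
    using xs by (auto simp: subdiff_def split: if_splits)
  then obtain F where F: "sup_fun T f x = ereal F" by auto
  note xs_le = subdiff_le[OF xs F]
  obtain C where L: "subspace L" "finite C" "span C = L" "x \<in> L"
    using L by (auto simp: fin_dim_subspaces_def)
  let ?A = "L \<inter> eff_dom (sup_fun T f)"
  define D where "D = {y. x + y \<in> ?A}"
  have "convex ?A"
    using L(1) conv by (intro convex_Int subspace_imp_convex convex_eff_dom convex_fun_sup_fun)
  then have "convex ((\<lambda>a. - x + a) ` ?A)"
    by (simp only: convex_translation_eq)
  moreover have "D = (\<lambda>a. - x + a) ` ?A"
    by (auto simp: D_def image_iff intro!: bexI[of _ "x + _"])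
  ultimately have convD: "convex D" by simp
  have x_A: "x \<in> ?A" using L(4) F by (simp add: eff_dom_def)
  then have zeroD: "0 \<in> D" by (simp add: D_def)
  have DL: "D \<subseteq> L"
  proof
    fix y assume "y \<in> D"
    then have "(x + y) - x \<in> L" using L(1,4) unfolding D_def by (intro subspace_diff) auto
    then show "y \<in> L" by simp
  qed
  \<comment> \<open>A basis of the span of \<open>D\<close>, which may be a proper subspace of
    \<open>L\<close>.\<close>
  obtain B where B: "B \<subseteq> D" "independent B" "D \<subseteq> span B"
    using maximal_independent_subset by blast
  have "finite B"
    using independent_span_bound[OF L(2) B(2)] B(1) DL L(3) by blast
  obtain e where e: "\<forall>b\<in>B. \<forall>b'\<in>B. dual_apply (e b) b' = (if b = b' then 1 else 0)"
    using dual_basis_exists[OF \<open>finite B\<close> B(2)] by blast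
  \<comment> \<open>Only a real number is subtracted, so inequalities can be shifted even where
    \<open>lim_fun\<close> is infinite; the next three facts do this.\<close>
  define h where "h \<gamma> y = lim_fun T f \<gamma> (x + y) - ereal (F + dual_apply xs y)" for \<gamma> y
  have h_le_iff: "h \<gamma> y \<le> ereal q \<longleftrightarrow> lim_fun T f \<gamma> (x + y) \<le> ereal (q + F + dual_apply xs y)" for \<gamma> y q
    unfolding h_def by (cases "lim_fun T f \<gamma> (x + y)") (auto simp: algebra_simps)
  have le_h_iff: "ereal q \<le> h \<gamma> y \<longleftrightarrow> ereal (q + F + dual_apply xs y) \<le> lim_fun T f \<gamma> (x + y)" for \<gamma> y q
    unfolding h_def by (cases "lim_fun T f \<gamma> (x + y)") (auto simp: algebra_simps)
  have less_h_iff: "ereal q < h \<gamma> y \<longleftrightarrow> ereal (q + F + dual_apply xs y) < lim_fun T f \<gamma> (x + y)" for \<gamma> y q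
    using h_le_iff[of \<gamma> y q] by (simp flip: not_le)
  have G_iff: "\<gamma> \<in> T_hat_at T f x \<longleftrightarrow> \<gamma> \<in> T_hat T \<and> ereal F \<le> lim_fun T f \<gamma> x" for \<gamma>
    by (simp add: T_hat_at_def F)
  have at_x: "lim_fun T f \<gamma> x = ereal F" if "\<gamma> \<in> T_hat_at T f x" for \<gamma>
    using that lim_fun_le_sup_fun[of T f \<gamma> x] by (simp add: G_iff F)
  \<comment> \<open>The conversion to a real loses nothing on \<open>D\<close>: the supremum is
    finite above by the choice of \<open>D\<close> and below by the subgradient inequality.\<close>
  define M where "M y = real_of_ereal (sup_fun T f (x + y)) - F - dual_apply xs y" for y
  have sup_D: "sup_fun T f (x + y) = ereal (M y + F + dual_apply xs y)" if "y \<in> D" for y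
  proof -
    have "sup_fun T f (x + y) < \<infinity>" using that by (simp add: D_def eff_dom_def)
    then show ?thesis using xs_le[of "x + y"]
      by (cases "sup_fun T f (x + y)") (auto simp: M_def)
  qed
  interpret active_convex_family B e D "T_hat_at T f x" h M
  proof unfold_locales
    show "finite B" "convex D" "0 \<in> D" "B \<subseteq> D" "D \<subseteq> span B"
      by fact+
    show "dual_apply (e b) b' = (if b = b' then 1 else 0)" if "b \<in> B" "b' \<in> B" for b b'
      using e that by blast
  next
    fix \<gamma> assume \<gamma>: "\<gamma> \<in> T_hat_at T f x"
    show "convex {(y, q). y \<in> D \<and> h \<gamma> y \<le> ereal q}"
    proof (rule convexI)
      fix p p' and u v :: real
      assume pp': "p \<in> {(y, q). y \<in> D \<and> h \<gamma> y \<le> ereal q}" "p' \<in> {(y, q). y \<in> D \<and> h \<gamma> y \<le> ereal q}"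
        and uv: "0 \<le> u" "0 \<le> v" "u + v = 1"
      obtain y q y' q' where p: "p = (y, q)" "p' = (y', q')" by (meson surj_pair)
      have D: "y \<in> D" "y' \<in> D" and le: "h \<gamma> y \<le> ereal q" "h \<gamma> y' \<le> ereal q'"
        using pp' p by auto
      have "convex_fun (lim_fun T f \<gamma>)"
        using \<gamma> T_hat_subset by (intro convex_fun_lim_fun conv) (auto simp: G_iff)
      from convex_funD[OF this le[unfolded h_le_iff] uv]
      have "lim_fun T f \<gamma> (u *\<^sub>R (x + y) + v *\<^sub>R (x + y'))
          \<le> ereal (u * (q + F + dual_apply xs y) + v * (q' + F + dual_apply xs y'))" .
      also have "u *\<^sub>R (x + y) + v *\<^sub>R (x + y') = (u + v) *\<^sub>R x + (u *\<^sub>R y + v *\<^sub>R y')"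
        by (simp add: algebra_simps)
      also have "u * (q + F + dual_apply xs y) + v * (q' + F + dual_apply xs y')
          = (u * q + v * q') + (u + v) * F + dual_apply xs (u *\<^sub>R y + v *\<^sub>R y')"
        by (simp add: algebra_simps dual_apply_linear_simps)
      finally have "h \<gamma> (u *\<^sub>R y + v *\<^sub>R y') \<le> ereal (u * q + v * q')"
        unfolding uv(3) h_le_iff by simp
      moreover have "u *\<^sub>R y + v *\<^sub>R y' \<in> D" using convD D uv by (intro convexD)
      ultimately show "u *\<^sub>R p + v *\<^sub>R p' \<in> {(y, q). y \<in> D \<and> h \<gamma> y \<le> ereal q}"
        by (simp add: p)
    qed
    show "h \<gamma> 0 = 0"
      using at_x[OF \<gamma>] by (simp add: h_def dual_apply_linear_simps)
    show "h \<gamma> y \<le> ereal (M y)" if "y \<in> D" for y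
      unfolding h_le_iff using lim_fun_le_sup_fun[of T f \<gamma> "x + y"] sup_D[OF that] by simp
  next
    fix y assume y: "y \<in> D"
    \<comment> \<open>The lower bound along the segment, with slope \<open>dual_apply xs y\<close>,
      that \<open>ex_active_on_segment\<close> asks for. Its conclusion at \<open>s = 0\<close>
      makes \<open>\<gamma>\<close> active at \<open>x\<close>.\<close>
    have "ereal (F + s * dual_apply xs y) \<le> sup_fun T f (x + s *\<^sub>R y)" for s
      using xs_le[of "x + s *\<^sub>R y"] by (simp add: dual_apply_linear_simps)
    then obtain \<gamma> where \<gamma>: "\<gamma> \<in> T_hat T"
      "\<And>s. 0 \<le> s \<Longrightarrow> s \<le> 1 \<Longrightarrow> ereal (F + s * dual_apply xs y) \<le> lim_fun T f \<gamma> (x + s *\<^sub>R y)"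
      using ex_active_on_segment[OF conv F eq_refl[OF sup_D[OF y]]] by blast
    have "\<gamma> \<in> T_hat_at T f x" using \<gamma>(1) \<gamma>(2)[of 0] by (simp add: G_iff)
    moreover have "0 \<le> h \<gamma> (s *\<^sub>R y)" if "0 < s" "s \<le> 1" for s
      using \<gamma>(2)[of s] that le_h_iff[of 0 \<gamma> "s *\<^sub>R y"]
      by (simp add: dual_apply_linear_simps zero_ereal_def)
    ultimately show "\<exists>\<gamma>\<in>T_hat_at T f x. \<forall>s. 0 < s \<longrightarrow> s \<le> 1 \<longrightarrow> 0 \<le> h \<gamma> (s *\<^sub>R y)"
      by blast
  next
    fix gs :: "nat \<Rightarrow> _" assume gs: "\<And>k. gs k \<in> T_hat_at T f x"
    then have "\<And>k. gs k \<in> T_hat T" by (simp add: G_iff)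
    then obtain \<gamma> where \<gamma>: "\<gamma> \<in> T_hat T" "\<And>z r.
        (\<forall>\<^sub>F k in sequentially. ereal r < lim_fun T f (gs k) z) \<Longrightarrow> ereal r \<le> lim_fun T f \<gamma> z"
      using T_hat_cluster[of gs T f] by blast
    \<comment> \<open>Activity passes to the cluster point: all values at \<open>x\<close> equal
      \<open>F\<close>, so every real below \<open>F\<close> is an eventual strict lower
      bound.\<close>
    have "ereal F \<le> lim_fun T f \<gamma> x"
    proof (rule dense_le)
      fix z assume z: "z < ereal F"
      show "z \<le> lim_fun T f \<gamma> x"
      proof (cases z)
        case (real r)
        then have "\<forall>\<^sub>F k in sequentially. ereal r < lim_fun T f (gs k) x"
          using z at_x[OF gs] by simp
        then show ?thesis using \<gamma>(2) real by simp
      qed (use z in auto)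
    qed
    then have "\<gamma> \<in> T_hat_at T f x" using \<gamma>(1) by (simp add: G_iff)
    then show "\<exists>\<gamma>\<in>T_hat_at T f x. \<forall>y\<in>D. \<forall>r.
        (\<forall>\<^sub>F k in sequentially. ereal r < h (gs k) y) \<longrightarrow> ereal r \<le> h \<gamma> y"
      unfolding less_h_iff le_h_iff using \<gamma>(2) by blast
  qed
  have "xs + c \<in> ?W" if "c \<in> all_subgradients" for c
  proof -
    obtain \<gamma> where \<gamma>: "\<gamma> \<in> T_hat_at T f x" "\<And>y. y \<in> D \<Longrightarrow> ereal (dual_apply c y) \<le> h \<gamma> y"
      using \<open>c \<in> all_subgradients\<close> by (auto simp: all_subgradients_def subgradients_def)
    let ?g = "\<lambda>z. lim_fun T f \<gamma> z + indicator_fun ?A z"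
    have gx: "?g x = ereal F" using x_A at_x[OF \<gamma>(1)] by (simp add: indicator_fun_def)
    have "ereal F + ereal (dual_apply (xs + c) (y - x)) \<le> ?g y" for y
    proof (cases "y \<in> ?A")
      case True
      then have "y - x \<in> D" by (simp add: D_def)
      from \<gamma>(2)[OF this] show ?thesis
        using True unfolding le_h_iff by (simp add: indicator_fun_def algebra_simps)
    qed (auto simp: indicator_fun_def)
    then have "xs + c \<in> subdiff ?g x"
      unfolding subdiff_def gx by simp
    then show ?thesis using \<gamma>(1) by blast
  qed
  then have "convex hull ((+) xs ` all_subgradients) \<subseteq> convex hull ?W"
    by (intro hull_mono) blast
  moreover have "xs + 0 \<in> (+) xs ` (convex hull all_subgradients)"
    using zero_in_hull by (rule imageI)
  ultimately show ?thesis
    unfolding convex_hull_translation by auto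
qed

text \<open>For fixed \<open>y\<close> the functionals satisfying the subgradient inequality at
  \<open>y\<close> form a convex set, so it suffices to check the generators of the hull.\<close>

lemma hull_subset_subdiff_sup_fun:
  assumes "\<And>L. L \<in> fin_dim_subspaces x \<Longrightarrow> xs \<in> convex hull (\<Union>\<gamma>\<in>T_hat_at T f x.
    subdiff (\<lambda>z. lim_fun T f \<gamma> z + indicator_fun (L \<inter> eff_dom (sup_fun T f)) z) x)"
  shows "xs \<in> subdiff (sup_fun T f) x"
proof -
  have span_in: "span {x, y} \<in> fin_dim_subspaces x" for y
    unfolding fin_dim_subspaces_def by (auto intro!: exI[of _ "{x, y}"] span_base)
  \<comment> \<open>A nonempty hull has a generator, hence an active index, and active indices exist
    only where the supremum is finite.\<close>
  have "T_hat_at T f x \<noteq> {}"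
    using assms[OF span_in] by auto
  then have fin: "\<bar>sup_fun T f x\<bar> \<noteq> \<infinity>"
    by (auto simp: T_hat_at_def split: if_splits)
  then obtain F where F: "sup_fun T f x = ereal F" by auto
  have "ereal F + ereal (dual_apply xs (y - x)) \<le> sup_fun T f y" for y
  proof (cases "y \<in> eff_dom (sup_fun T f)")
    case True
    let ?A = "span {x, y} \<inter> eff_dom (sup_fun T f)"
    let ?H = "{c. ereal F + ereal (dual_apply c (y - x)) \<le> sup_fun T f y}"
    have A: "x \<in> ?A" "y \<in> ?A"
      using True F by (auto simp: eff_dom_def intro: span_base)
    have "c \<in> ?H" if \<gamma>: "\<gamma> \<in> T_hat_at T f x"
      and c: "c \<in> subdiff (\<lambda>z. lim_fun T f \<gamma> z + indicator_fun ?A z) x" for \<gamma> c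
    proof -
      have "lim_fun T f \<gamma> x = ereal F"
        using \<gamma> lim_fun_le_sup_fun[of T f \<gamma> x] by (simp add: T_hat_at_def F)
      then have "ereal (F + dual_apply c (y - x)) \<le> lim_fun T f \<gamma> y + indicator_fun ?A y"
        using A by (intro subdiff_le[OF c]) (simp add: indicator_fun_def)
      also have "\<dots> \<le> sup_fun T f y"
        using A lim_fun_le_sup_fun[of T f \<gamma> y] by (simp add: indicator_fun_def)
      finally show ?thesis by simp
    qed
    moreover have "convex ?H"
    proof (rule convexI)
      fix c c' and u v :: real
      assume c: "c \<in> ?H" "c' \<in> ?H" and uv: "0 \<le> u" "0 \<le> v" "u + v = 1"
      show "u *\<^sub>R c + v *\<^sub>R c' \<in> ?H"
      proof (cases "sup_fun T f y")
        case (real S)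
        have "u * (F + dual_apply c (y - x)) + v * (F + dual_apply c' (y - x)) \<le> S"
          using c uv real by (intro convex_bound_le) auto
        moreover have "u * (F + dual_apply c (y - x)) + v * (F + dual_apply c' (y - x))
            = (u + v) * F + dual_apply (u *\<^sub>R c + v *\<^sub>R c') (y - x)"
          by (simp add: algebra_simps)
        ultimately show ?thesis unfolding uv(3) using real by simp
      qed (use c in auto)
    qed
    ultimately have "convex hull (\<Union>\<gamma>\<in>T_hat_at T f x.
        subdiff (\<lambda>z. lim_fun T f \<gamma> z + indicator_fun ?A z) x) \<subseteq> ?H"
      by (intro hull_minimal) blast
    then show ?thesis using assms[OF span_in[of y]] by blast
  qed (simp add: eff_dom_def)
  then show ?thesis unfolding subdiff_def F by simp
qed

theorem theorem4:
  fixes T :: "'t topology"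
    and f :: "'t \<Rightarrow> 'a::locally_convex_space \<Rightarrow> ereal"
    and x :: 'a
  assumes "topspace T \<noteq> {}"
    and "\<And>t. t \<in> topspace T \<Longrightarrow> convex_fun (f t)"
  shows "subdiff (sup_fun T f) x =
    (\<Inter>L\<in>fin_dim_subspaces x.
      convex hull (\<Union>\<gamma>\<in>T_hat_at T f x.
        subdiff (\<lambda>z. lim_fun T f \<gamma> z + indicator_fun (L \<inter> eff_dom (sup_fun T f)) z) x))"
  using subdiff_sup_fun_subset[of T f _ x, OF assms(2)] hull_subset_subdiff_sup_fun[of x _ T f]
  by (intro subset_antisym subsetI INT_I) blast+

end
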